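(* Let $\{c_n\}_{n\ge1}$ be a sequence of positive numbers such that $$\liminf_{n\to\infty}\frac{n}{c_n^2}\,(c_{n+1}^2-c_n^2)>1 .$$ Then for any Borel function $f:\mathbb{R}\to\mathbb{R}$, $$c_n^{-1}\sum_{k=1}^n\Big(f(a_k)-\mathrm{E}\big[f(a_k)I_{[|f(a_k)|\le c_n]}\big]\Big)\longrightarrow 0\ \text{ in } \mathrm{P}\text{-probability}$$ if and only if $$n\,\mathrm{P}[|f(a_1)|>c_n]\to 0\quad\text{as } n\to\infty .$$
   Context: For irrational $x\in(0,1]$, $a_n(x)\in\mathbb{N}=\{1,2,\ldots\}$, $n\ge1$, denote the partial quotients (digits) of the simple non-terminating continued fraction expansion $x=\cfrac{1}{a_1(x)+\cfrac{1}{a_2(x)+\cdots}}$. The sequence $\{a_n\}$ is regarded as a random sequence on the probability space $((0,1],\mathcal{B},\mathrm{P})$, where $\mathcal{B}$ is the Borel $\sigma$-field of $(0,1]$ and $\mathrm{P}$ is the Gauss measure $\mathrm{P}(A)=\frac{1}{\ln 2}\int_A\frac{dx}{1+x}$. $\mathrm{E}$ denotes expectation with respect to $\mathrm{P}$ and $I_{[\cdot]}$ the indicator of an event. *)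

theory Defs
  imports "HOL-Probability.Probability"
begin

section \<open>Regular continued fractions\<close>

text \<open>
  \<open>cf_convergent n a\<close> is the finite continued fraction \<open>[0; a 1, \<dots>, a n]\<close>.
  Sequences of digits are indexed from 1; the value \<open>a 0\<close> is irrelevant.
\<close>

primrec cf_convergent :: "nat \<Rightarrow> (nat \<Rightarrow> nat) \<Rightarrow> real" where
  "cf_convergent 0 a = 0"
| "cf_convergent (Suc n) a = 1 / (real (a 1) + cf_convergent n (\<lambda>k. a (Suc k)))"

definition cf_expansion :: "real \<Rightarrow> (nat \<Rightarrow> nat) \<Rightarrow> bool" where
  "cf_expansion x a \<longleftrightarrow> (\<forall>n\<ge>1. 1 \<le> a n) \<and> (\<lambda>n. cf_convergent n a) \<longlonglongrightarrow> x"

text \<open>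
  The description is unique for \<open>n \<ge> 1\<close> and irrational \<open>x\<close> between 0 and 1 (see
  \<open>cf_digit_unique\<close> below). No rational number has a non-terminating expansion, so
  on the countable set of rationals the value is an unspecified constant.
\<close>

definition cf_digit :: "nat \<Rightarrow> real \<Rightarrow> nat" where
  "cf_digit n x = (THE m. \<exists>a. cf_expansion x a \<and> a n = m)"


section \<open>The Gauss measure and convergence in probability\<close>

definition gauss_measure :: "real measure" where
  "gauss_measure =
     density (restrict_space lborel {0<..1}) (\<lambda>x. ennreal (1 / (ln 2 * (1 + x))))"

definition tendsto_in_prob :: "'a measure \<Rightarrow> (nat \<Rightarrow> 'a \<Rightarrow> real) \<Rightarrow> ('a \<Rightarrow> real) \<Rightarrow> bool" where
  "tendsto_in_prob M X Y \<longleftrightarrow>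
     (\<forall>\<epsilon>>0. (\<lambda>n. measure M {\<omega> \<in> space M. \<bar>X n \<omega> - Y \<omega>\<bar> > \<epsilon>}) \<longlonglongrightarrow> 0)"


section \<open>Basic facts\<close>

lemma space_gauss_measure [simp]: "space gauss_measure = {0<..1}"
  by (simp add: gauss_measure_def space_restrict_space)

lemma sets_gauss_measure: "sets gauss_measure = sets (restrict_space borel {0<..1})"
  unfolding gauss_measure_def sets_density by (rule sets_restrict_space_cong) simp

lemma prob_space_gauss_measure: "prob_space gauss_measure"
proof
  have "emeasure gauss_measure (space gauss_measure) =
      (\<integral>\<^sup>+x. ennreal (1 / (ln 2 * (1 + x))) \<partial>restrict_space lborel {0<..1})"
    unfolding gauss_measure_def
    by (subst emeasure_density)
       (auto intro!: nn_integral_cong measurable_restrict_space1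
         simp: space_restrict_space sets_restrict_space)
  also have "\<dots> = (\<integral>\<^sup>+x. ennreal (1 / (ln 2 * (1 + x))) * indicator {0<..1} x \<partial>lborel)"
    by (subst nn_integral_restrict_space) auto
  also have "\<dots> = (\<integral>\<^sup>+x. ennreal (1 / (ln 2 * (1 + x))) * indicator {0..1} x \<partial>lborel)"
    by (rule nn_integral_cong_AE, rule eventually_mono[OF AE_lborel_singleton[of "0::real"]])
       (simp add: indicator_def)
  also have "\<dots> = ennreal (ln (1 + 1) / ln 2 - ln (1 + 0) / ln 2)"
    by (rule nn_integral_FTC_Icc[where F = "\<lambda>x. ln (1 + x) / ln 2"])
       (auto intro!: derivative_eq_intros simp: divide_simps)
  also have "\<dots> = 1" by simp
  finally show "emeasure gauss_measure (space gauss_measure) = 1" .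
qed

primrec cf_tail :: "nat \<Rightarrow> (nat \<Rightarrow> nat) \<Rightarrow> real \<Rightarrow> real" where
  "cf_tail 0 a t = t"
| "cf_tail (Suc n) a t = 1 / (real (a 1) + cf_tail n (\<lambda>k. a (Suc k)) t)"

lemma cf_convergent_eq_cf_tail: "cf_convergent n a = cf_tail n a 0"
  by (induction n arbitrary: a) auto

lemma cf_tail_cong:
  assumes "\<And>m. 1 \<le> m \<Longrightarrow> a m = b m"
  shows "cf_tail n a t = cf_tail n b t"
  using assms
proof (induction n arbitrary: a b)
  case (Suc n)
  have "cf_tail n (\<lambda>k. a (Suc k)) t = cf_tail n (\<lambda>k. b (Suc k)) t"
    by (rule Suc.IH) (simp add: Suc.prems)
  then show ?case by (simp add: Suc.prems)
qed simp

lemma inverse_add_bounds: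
  assumes "1 \<le> m" "0 \<le> t"
  shows "0 \<le> 1 / (real m + t)" "1 / (real m + t) \<le> 1"
  using assms by (auto simp: divide_le_eq_1)

lemma cf_tail_bounds:
  assumes "\<forall>n\<ge>1. 1 \<le> a n" "0 \<le> t" "t \<le> 1"
  shows "0 \<le> cf_tail n a t \<and> cf_tail n a t \<le> 1"
  using assms
proof (induction n arbitrary: a)
  case (Suc n)
  have "0 \<le> cf_tail n (\<lambda>k. a (Suc k)) t" using Suc by auto
  then show ?case using inverse_add_bounds[of "a 1"] Suc.prems(1) by auto
qed auto

lemma cf_step_diff:
  assumes "1 \<le> m" "0 \<le> s" "0 \<le> t"
  shows "\<bar>1 / (real m + s) - 1 / (real m + t)\<bar> = \<bar>s - t\<bar> / ((real m + s) * (real m + t))"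
proof -
  have pos: "0 < real m + s" "0 < real m + t" using assms by auto
  then have "1 / (real m + s) - 1 / (real m + t) = (t - s) / ((real m + s) * (real m + t))"
    by (simp add: divide_simps)
  then show ?thesis using pos by (simp add: abs_mult abs_minus_commute)
qed

lemma cf_two_steps_diff:
  assumes "1 \<le> m" "1 \<le> k" "0 \<le> s" "0 \<le> t"
  shows "\<bar>1 / (real m + 1 / (real k + s)) - 1 / (real m + 1 / (real k + t))\<bar> \<le> \<bar>s - t\<bar> / 4"
proof -
  have pos: "1 \<le> real k + s" "1 \<le> real k + t" using assms by auto
  have two: "2 \<le> (real k + u) * (real m + 1 / (real k + u))" if "0 \<le> u" for u
  proof -
    have k: "1 \<le> real k + u" using assms that by auto
    then have "(real k + u) * (real m + 1 / (real k + u)) = (real k + u) * real m + 1"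
      by (simp add: field_simps)
    moreover have "1 * 1 \<le> (real k + u) * real m" using k assms by (intro mult_mono) auto
    ultimately show ?thesis by simp
  qed
  have "\<bar>1 / (real m + 1 / (real k + s)) - 1 / (real m + 1 / (real k + t))\<bar> =
      \<bar>s - t\<bar> / ((real k + s) * (real k + t)) /
        ((real m + 1 / (real k + s)) * (real m + 1 / (real k + t)))"
    using assms by (subst cf_step_diff) (auto simp: cf_step_diff)
  also have "\<dots> = \<bar>s - t\<bar> / (((real k + s) * (real m + 1 / (real k + s))) *
      ((real k + t) * (real m + 1 / (real k + t))))"
    by (simp add: mult.assoc mult.left_commute)
  also have "\<dots> \<le> \<bar>s - t\<bar> / (2 * 2)"
    using two[OF assms(3)] two[OF assms(4)] by (intro divide_left_mono mult_mono) auto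
  finally show ?thesis by simp
qed

lemma cf_tail_diff:
  assumes "\<forall>n\<ge>1. 1 \<le> a n" "0 \<le> s" "s \<le> 1" "0 \<le> t" "t \<le> 1"
  shows "\<bar>cf_tail n a s - cf_tail n a t\<bar> \<le> 2 * (1 / 2) ^ n"
  using assms
proof (induction n arbitrary: a rule: induct_nat_012)
  case 1
  have "\<bar>cf_tail 1 a s - cf_tail 1 a t\<bar> \<le> 1"
    using cf_tail_bounds[OF 1(1-3), of 1] cf_tail_bounds[OF 1(1,4,5), of 1] by linarith
  then show ?case by simp
next
  case (ge2 n)
  let ?b = "\<lambda>k. a (Suc (Suc k))"
  have b: "\<forall>n\<ge>1. 1 \<le> ?b n" and a: "1 \<le> a 1" "1 \<le> a 2" using ge2.prems by auto
  have "\<bar>cf_tail (Suc (Suc n)) a s - cf_tail (Suc (Suc n)) a t\<bar>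
      \<le> \<bar>cf_tail n ?b s - cf_tail n ?b t\<bar> / 4"
    using cf_two_steps_diff[OF a, of "cf_tail n ?b s" "cf_tail n ?b t"]
      cf_tail_bounds[OF b, of s n] cf_tail_bounds[OF b, of t n] ge2.prems
    by (simp add: numeral_2_eq_2)
  also have "\<dots> \<le> 2 * (1 / 2) ^ n / 4" using ge2.IH(1)[OF b] ge2.prems by auto
  finally show ?case by simp
qed auto

definition gauss_map :: "real \<Rightarrow> real" where
  "gauss_map x = frac (1 / x)"

lemma gauss_map_bounds:
  assumes "x \<notin> \<rat>"
  shows "0 < gauss_map x" "gauss_map x < 1" "gauss_map x \<notin> \<rat>"
proof -
  have "1 / x \<notin> \<rat>" using assms Rats_inverse[of "1 / x"] by (auto simp: inverse_eq_divide)
  then show "gauss_map x \<notin> \<rat>"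
    unfolding gauss_map_def frac_def
    by (metis Rats_add Rats_of_int diff_add_cancel)
  then have "gauss_map x \<noteq> 0" by auto
  then show "0 < gauss_map x" "gauss_map x < 1"
    unfolding gauss_map_def using frac_ge_0[of "1 / x"] frac_lt_1[of "1 / x"]
    by linarith+
qed

lemma cf_expansion_bounds:
  assumes "cf_expansion x a"
  shows "0 \<le> x" "x \<le> 1"
proof -
  have b: "0 \<le> cf_convergent n a \<and> cf_convergent n a \<le> 1" for n
    using cf_tail_bounds[of a 0 n] assms by (simp add: cf_convergent_eq_cf_tail cf_expansion_def)
  have lim: "(\<lambda>n. cf_convergent n a) \<longlonglongrightarrow> x"
    using assms by (simp add: cf_expansion_def)
  show "0 \<le> x" by (rule LIMSEQ_le_const[OF lim]) (simp add: b)
  show "x \<le> 1" by (rule LIMSEQ_le_const2[OF lim]) (simp add: b)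
qed

lemma cf_expansion_step:
  assumes "cf_expansion x a" "x \<notin> \<rat>"
  shows "a 1 = nat \<lfloor>1 / x\<rfloor>" "cf_expansion (gauss_map x) (\<lambda>k. a (Suc k))"
proof -
  let ?b = "\<lambda>k. a (Suc k)"
  have a: "\<forall>n\<ge>1. 1 \<le> a n" and lim: "(\<lambda>n. cf_convergent n a) \<longlonglongrightarrow> x"
    using assms by (auto simp: cf_expansion_def)
  have x0: "x \<noteq> 0" using assms by auto
  have "(\<lambda>n. 1 / cf_convergent (Suc n) a - real (a 1)) \<longlonglongrightarrow> 1 / x - real (a 1)"
    by (intro tendsto_intros LIMSEQ_Suc lim x0)
  moreover have "1 / cf_convergent (Suc n) a - real (a 1) = cf_convergent n ?b" for n
    by simp
  ultimately have exp: "cf_expansion (1 / x - real (a 1)) ?b"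
    using a by (simp add: cf_expansion_def)
  have irr: "1 / x \<notin> \<rat>"
    using assms(2) Rats_inverse[of "1 / x"] by (auto simp: inverse_eq_divide)
  have "1 / x \<noteq> real (a 1) + 1"
  proof
    assume "1 / x = real (a 1) + 1"
    then have "1 / x = real (Suc (a 1))" by simp
    then show False using irr Rats_of_nat by metis
  qed
  then have fl: "\<lfloor>1 / x\<rfloor> = int (a 1)"
    using cf_expansion_bounds[OF exp] by (intro floor_unique) auto
  then show "a 1 = nat \<lfloor>1 / x\<rfloor>" by simp
  show "cf_expansion (gauss_map x) ?b"
    using exp fl by (simp add: gauss_map_def frac_def)
qed

lemma cf_expansion_digit:
  assumes "cf_expansion x a" "x \<notin> \<rat>"
  shows "a (Suc n) = nat \<lfloor>1 / (gauss_map ^^ n) x\<rfloor>"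
  using assms
proof (induction n arbitrary: x a)
  case 0
  then show ?case using cf_expansion_step(1)[of x a] by simp
next
  case (Suc n)
  then show ?case
    using Suc.IH[OF cf_expansion_step(2)[OF Suc.prems]] gauss_map_bounds(3)
    by (simp add: funpow_swap1)
qed

lemma cf_expansion_exists:
  assumes "x \<notin> \<rat>" "0 < x" "x \<le> 1"
  shows "cf_expansion x (\<lambda>n. nat \<lfloor>1 / (gauss_map ^^ (n - 1)) x\<rfloor>)"
proof -
  define d where "d = (\<lambda>y n. nat \<lfloor>1 / (gauss_map ^^ (n - 1)) y\<rfloor>)"
  have orbit: "(gauss_map ^^ n) y \<notin> \<rat> \<and> 0 < (gauss_map ^^ n) y \<and> (gauss_map ^^ n) y \<le> 1"
    if "y \<notin> \<rat>" "0 < y" "y \<le> 1" for n y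
    using that
  proof (induction n)
    case (Suc n)
    then have "(gauss_map ^^ n) y \<notin> \<rat>" by simp
    from gauss_map_bounds[OF this] show ?case by simp
  qed simp
  have pos: "\<forall>n\<ge>1. 1 \<le> d x n"
  proof (intro allI impI)
    fix n :: nat
    have "1 \<le> 1 / (gauss_map ^^ (n - 1)) x"
      using orbit[OF assms, of "n - 1"] by simp
    then have "1 \<le> \<lfloor>1 / (gauss_map ^^ (n - 1)) x\<rfloor>" by linarith
    then show "1 \<le> d x n" unfolding d_def by linarith
  qed
  have tail: "cf_tail n (d y) ((gauss_map ^^ n) y) = y" if "y \<notin> \<rat>" "0 < y" "y \<le> 1" for n y
    using that
  proof (induction n arbitrary: y)
    case (Suc n)
    have g: "gauss_map y \<notin> \<rat>" "0 < gauss_map y" "gauss_map y \<le> 1"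
      using gauss_map_bounds[OF Suc.prems(1)] by auto
    have "(gauss_map ^^ (m - 1)) (gauss_map y) = (gauss_map ^^ m) y" if "1 \<le> m" for m
      using that by (cases m) (simp_all add: funpow_swap1)
    then have "cf_tail n (\<lambda>k. d y (Suc k)) ((gauss_map ^^ n) (gauss_map y)) =
        cf_tail n (d (gauss_map y)) ((gauss_map ^^ n) (gauss_map y))"
      by (intro cf_tail_cong) (simp add: d_def)
    then have "cf_tail n (\<lambda>k. d y (Suc k)) ((gauss_map ^^ Suc n) y) = gauss_map y"
      using Suc.IH[OF g] by (simp add: funpow_swap1)
    moreover have "real (d y 1) + gauss_map y = 1 / y"
      using Suc.prems by (simp add: d_def gauss_map_def frac_def)
    ultimately show ?case by (simp only: cf_tail.simps) simp
  qed simp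
  have "\<bar>cf_convergent n (d x) - x\<bar> \<le> 2 * (1 / 2) ^ n" for n
    using cf_tail_diff[OF pos, of 0 "(gauss_map ^^ n) x" n] orbit[OF assms, of n]
      tail[OF assms, of n]
    by (simp add: cf_convergent_eq_cf_tail)
  then have "\<forall>\<^sub>F n in sequentially. norm (cf_convergent n (d x) - x) \<le> 2 * (1 / 2) ^ n"
    by simp
  moreover have "(\<lambda>n. 2 * (1 / 2 :: real) ^ n) \<longlonglongrightarrow> 0"
    by (intro tendsto_mult_right_zero LIMSEQ_realpow_zero) auto
  ultimately have "(\<lambda>n. cf_convergent n (d x) - x) \<longlonglongrightarrow> 0"
    by (rule Lim_null_comparison)
  then have "(\<lambda>n. cf_convergent n (d x)) \<longlonglongrightarrow> x" by (simp add: LIM_zero_iff)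
  then show ?thesis using pos by (simp add: cf_expansion_def d_def)
qed

lemma cf_digit_unique:
  assumes "x \<notin> \<rat>" "0 < x" "x \<le> 1" "1 \<le> n"
  shows "\<exists>!m. \<exists>a. cf_expansion x a \<and> a n = m"
proof -
  obtain k where n: "n = Suc k" using assms(4) by (cases n) auto
  have "m = nat \<lfloor>1 / (gauss_map ^^ k) x\<rfloor>" if "\<exists>a. cf_expansion x a \<and> a n = m" for m
    using that cf_expansion_digit[OF _ assms(1), of _ k] n by blast
  then show ?thesis using cf_expansion_exists[OF assms(1-3)] by metis
qed

lemma cf_digit_eqI:
  assumes "cf_expansion x a" "x \<notin> \<rat>" "1 \<le> n"
  shows "cf_digit n x = a n"
proof -
  obtain k where n: "n = Suc k" using assms(3) by (cases n) auto
  show ?thesis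
    unfolding cf_digit_def
  proof (rule the_equality)
    show "\<exists>b. cf_expansion x b \<and> b n = a n" using assms(1) by blast
  next
    fix m assume "\<exists>b. cf_expansion x b \<and> b n = m"
    then obtain b where b: "cf_expansion x b" "b n = m" by blast
    show "m = a n"
      using cf_expansion_digit[OF b(1) assms(2), of k] b(2)
        cf_expansion_digit[OF assms(1,2), of k] by (simp only: n)
  qed
qed

lemma cf_digit_eq:
  assumes "x \<notin> \<rat>" "0 < x" "x \<le> 1"
  shows "cf_digit (Suc n) x = nat \<lfloor>1 / (gauss_map ^^ n) x\<rfloor>"
  using cf_digit_eqI[OF cf_expansion_exists[OF assms] assms(1), of "Suc n"] by simp

end

theory Submission
  imports Defs
begin

text \<open>
  The Gauss measure is mixed from the inverse branches \<open>x \<mapsto> 1 / (x + i + 1)\<close> with weights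
  \<open>(x + 1) / ((x + i + 1) (x + i + 2))\<close>, which yields two mixing properties of the digits. Iterating
  the branches multiplies the weights to functions \<open>(1 + x) / ((a + b x) (c + d x))\<close> that vary on the
  unit interval by a factor of at most 4, so past and future are independent up to this factor. Averaging
  over one branch contracts Lipschitz constants by \<open>7 / 8\<close>, so covariances of nonnegative functions of
  the digits are bounded above by a geometric sequence and variances of sums grow linearly.

  Sufficiency: truncate and apply Chebyshev's inequality. The growth of \<open>c\<close> makes \<open>d n = (c n)\<^sup>2 / n\<close>
  increase to infinity, and the increments of \<open>E min (X\<^sup>2, (c n)\<^sup>2)\<close> are \<open>o(d (n + 1) - d n)\<close>, so that
  \<open>n E min (X\<^sup>2, (c n)\<^sup>2) = o((c n)\<^sup>2)\<close>. Necessity: the weak law forces the centering constants to be almost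
  additive; then Ottaviani's inequality, with independence replaced by quasi-independence, bounds
  the largest summand, and quasi-independence turns this into the tail condition.
\<close>

section \<open>Branches of the Gauss map\<close>

text \<open>The digits are stationary but dependent, so the symmetrization and the product formulas
  of the independent case are not at hand. Two one-sided bounds replace them: a lower bound on joint
  probabilities, uniform in the length of the past, serves the maximal inequality and the largest
  summand; an upper bound on joint expectations serves the variance. The threshold 1 in the
  hypothesis is the rate of \<open>c n = sqrt n\<close>, for which \<open>(c n)\<^sup>2 / n\<close>
  is constant. A ratio of at least 1 + \<delta> means that \<open>d n = (c n)\<^sup>2 / n\<close>
  satisfies d (n + 1) - d n >= \<delta> d n / (n + 1), and this is the form in which the hypothesis
  enters. All estimates are made for \<open>gauss_borel\<close>, the Gauss measure carried over to
  the whole real line: events are then plain Borel sets, and pulling back along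
  \<open>gauss_map\<close> requires no intersection with the unit interval. The set
  \<open>irr_unit\<close> has full measure, is mapped into itself by all branches, and is where the
  digit formulas are exact.\<close>

definition gauss_borel :: "real measure" where
  "gauss_borel = distr gauss_measure borel (\<lambda>x. x)"

definition branch :: "nat \<Rightarrow> real \<Rightarrow> real" where
  "branch i x = 1 / (x + real i + 1)"

text \<open>The conditional probability that the first digit is i + 1, given that
  \<open>gauss_map\<close> leads to x: the absolute value of the derivative of
  \<open>branch i\<close> times the ratio of the Gauss densities at \<open>branch i x\<close> and at
  x.\<close>

definition weight :: "nat \<Rightarrow> real \<Rightarrow> real" where
  "weight i x = (x + 1) / ((x + real i + 1) * (x + real i + 2))"

text \<open>Counts from 0 and is given by an explicit formula everywhere, which makes measurability
  immediate. On \<open>irr_unit\<close> it agrees with \<open>cf_digit (Suc k)\<close>.\<close>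

definition digit :: "nat \<Rightarrow> real \<Rightarrow> nat" where
  "digit k x = nat \<lfloor>1 / (gauss_map ^^ k) x\<rfloor>"

definition irr_unit :: "real set" where
  "irr_unit = {0<..<1} - \<rat>"

lemma measurable_ident_gauss_measure: "(\<lambda>x. x) \<in> gauss_measure \<rightarrow>\<^sub>M borel"
  by (subst measurable_cong_sets[OF sets_gauss_measure refl]) (rule measurable_restrict_space1, simp)

lemma space_gauss_borel [simp]: "space gauss_borel = UNIV"
  and sets_gauss_borel [simp, measurable_cong]: "sets gauss_borel = sets borel"
  by (simp_all add: gauss_borel_def)

interpretation gauss: prob_space gauss_borel
  unfolding gauss_borel_def
  by (rule prob_space.prob_space_distr[OF prob_space_gauss_measure measurable_ident_gauss_measure])

lemma nn_integral_gauss_borel: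
  assumes [measurable]: "H \<in> borel_measurable borel"
  shows "(\<integral>\<^sup>+x. H x \<partial>gauss_borel) =
    (\<integral>\<^sup>+x. ennreal (1 / (ln 2 * (1 + x))) * H x * indicator {0<..1} x \<partial>lborel)"
proof -
  have "(\<integral>\<^sup>+x. H x \<partial>gauss_borel) = (\<integral>\<^sup>+x. H x \<partial>gauss_measure)"
    unfolding gauss_borel_def by (subst nn_integral_distr[OF measurable_ident_gauss_measure]) auto
  also have "\<dots> = (\<integral>\<^sup>+x. ennreal (1 / (ln 2 * (1 + x))) * H x \<partial>restrict_space lborel {0<..1})"
    unfolding gauss_measure_def
    by (subst nn_integral_density) (auto intro!: measurable_restrict_space1)
  also have "\<dots> = (\<integral>\<^sup>+x. ennreal (1 / (ln 2 * (1 + x))) * H x * indicator {0<..1} x \<partial>lborel)"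
    by (subst nn_integral_restrict_space) auto
  finally show ?thesis .
qed

lemma irr_unit_borel [measurable]: "irr_unit \<in> sets borel"
proof -
  have "(\<rat> :: real set) \<in> sets borel"
    by (rule sets.countable[OF _ countable_rat]) simp
  then show ?thesis by (auto simp: irr_unit_def)
qed

lemma AE_irr_unit: "AE x in gauss_borel. x \<in> irr_unit"
proof -
  have "emeasure gauss_borel (- irr_unit) = (\<integral>\<^sup>+x. indicator (- irr_unit) x \<partial>gauss_borel)"
    by (subst nn_integral_indicator) (auto simp: Compl_in_sets_lebesgue)
  also have "\<dots> = (\<integral>\<^sup>+x. ennreal (1 / (ln 2 * (1 + x))) * indicator (- irr_unit) x
      * indicator {0<..1} x \<partial>lborel)"
    by (subst nn_integral_gauss_borel) auto
  also have "\<dots> = (\<integral>\<^sup>+x. 0 \<partial>(lborel :: real measure))"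
  proof (rule nn_integral_cong_AE)
    have "(\<rat> :: real set) \<in> null_sets lborel"
      using countable_rat by (rule countable_imp_null_set_lborel)
    then have "AE x in lborel. (x::real) \<notin> \<rat>" by (rule AE_not_in)
    then show "AE x in lborel. ennreal (1 / (ln 2 * (1 + x))) * indicator (- irr_unit) x
      * indicator {0<..1} x = 0"
    proof eventually_elim
      case (elim x)
      then have "x \<noteq> 1" by auto
      with elim show ?case by (auto simp: irr_unit_def indicator_def)
    qed
  qed
  finally have "emeasure gauss_borel (- irr_unit) = 0" by simp
  then show ?thesis
    by (intro AE_I[of _ _ "- irr_unit"]) auto
qed

lemma gauss_map_measurable [measurable]: "gauss_map \<in> borel_measurable borel"
  unfolding gauss_map_def frac_def by measurable

lemma gauss_map_funpow_measurable [measurable]: "(gauss_map ^^ k) \<in> borel_measurable borel"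
  by (induction k) (auto simp: o_def)

lemma digit_measurable [measurable]: "digit k \<in> borel \<rightarrow>\<^sub>M count_space UNIV"
  unfolding digit_def[abs_def] by measurable

lemma branch_measurable [measurable]: "branch i \<in> borel_measurable borel"
  unfolding branch_def[abs_def] by measurable

lemma weight_measurable [measurable]: "weight i \<in> borel_measurable borel"
  unfolding weight_def[abs_def] by measurable

lemma digit_Suc: "digit (Suc k) x = digit k (gauss_map x)"
  by (simp add: digit_def funpow_swap1)

lemma digit_funpow: "digit k ((gauss_map ^^ j) x) = digit (k + j) x"
  by (simp add: digit_def funpow_add)

lemma branch_irr_unit:
  assumes "x \<in> irr_unit"
  shows "branch i x \<in> irr_unit"
proof -
  have x: "0 < x" "x < 1" "x \<notin> \<rat>" using assms by (auto simp: irr_unit_def)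
  have "x = 1 / branch i x - real (Suc i)" by (simp add: branch_def)
  then have "branch i x \<notin> \<rat>"
    using x(3) by (metis Rats_1 Rats_diff Rats_divide Rats_of_nat)
  then show ?thesis using x by (auto simp: irr_unit_def branch_def)
qed

lemma gauss_map_branch:
  assumes "x \<in> irr_unit"
  shows "gauss_map (branch i x) = x"
proof -
  have x: "0 < x" "x < 1" using assms by (auto simp: irr_unit_def)
  have "1 / branch i x - x = of_int (int (Suc i))" by (simp add: branch_def)
  then show ?thesis
    unfolding gauss_map_def frac_unique_iff using x by (simp del: of_int_of_nat_eq)
qed

lemma digit_0_branch:
  assumes "x \<in> irr_unit"
  shows "digit 0 (branch i x) = Suc i"
proof -
  have x: "0 < x" "x < 1" using assms by (auto simp: irr_unit_def)
  have "1 / branch i x = x + real i + 1" by (simp add: branch_def)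
  moreover have "\<lfloor>x + real i + 1\<rfloor> = int (Suc i)"
    using x by (intro floor_unique) auto
  ultimately show ?thesis by (simp add: digit_def)
qed

lemma digit_Suc_branch:
  assumes "x \<in> irr_unit"
  shows "digit (Suc k) (branch i x) = digit k x"
  using gauss_map_branch[OF assms] by (simp add: digit_Suc)

lemma weight_nonneg: "0 \<le> x \<Longrightarrow> 0 \<le> weight i x"
  by (auto simp: weight_def)

text \<open>The weights telescope: \<open>weight i x\<close> is the increment of i / (x + i + 1).
  Besides the total mass 1, the closed form yields the partial sums needed for summation by
  parts.\<close>

lemma sum_weight:
  assumes "0 \<le> x"
  shows "(\<Sum>i<n. weight i x) = real n / (x + real n + 1)"
proof (induction n)
  case (Suc n)
  have "0 < x + real n + 1" "0 < x + real n + 2" using assms by auto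
  then have "real n / (x + real n + 1) + weight n x = real (Suc n) / (x + real (Suc n) + 1)"
    unfolding weight_def by (simp add: divide_simps) (simp add: algebra_simps)
  then show ?case using Suc by simp
qed simp

lemma weight_sums:
  assumes "0 \<le> x"
  shows "(\<lambda>i. weight i x) sums 1"
proof -
  have "(\<lambda>n. 1 - (x + 1) * inverse ((x + 1) + real n)) \<longlonglongrightarrow> 1 - (x + 1) * 0"
    by (intro tendsto_diff tendsto_mult tendsto_const tendsto_inverse_0_at_top
        filterlim_tendsto_add_at_top[OF tendsto_const filterlim_real_sequentially])
  moreover have "1 - (x + 1) * inverse ((x + 1) + real n) = (\<Sum>i<n. weight i x)" for n
    using assms by (simp add: sum_weight field_simps)
  ultimately show ?thesis by (simp add: sums_def)
qed

section \<open>Change of variables along the inverse branches\<close>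

lemma nn_integral_branch_interval:
  assumes [measurable]: "F \<in> borel_measurable borel"
  shows "(\<integral>\<^sup>+x. F x * indicator {1 / (real i + 2)..1 / (real i + 1)} x \<partial>lborel)
    = (\<integral>\<^sup>+x. F (branch i x) * ennreal (1 / (x + real i + 1)\<^sup>2) * indicator {0..1} x \<partial>lborel)"
proof -
  \<comment> \<open>Since \<open>branch i\<close> is decreasing, the substitution is made with the
    increasing map \<open>t \<mapsto> branch i (-t)\<close> on [-1, 0] and followed by a
    reflection.\<close>
  let ?g = "\<lambda>t. 1 / (real i + 1 - t)" and ?g' = "\<lambda>t. 1 / (real i + 1 - t)\<^sup>2"
  have "(\<integral>\<^sup>+x. F x * indicator {?g (-1)..?g 0} x \<partial>lborel)
      = (\<integral>\<^sup>+x. F (?g x) * ?g' x * indicator {-1..0} x \<partial>lborel)"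
  proof (rule nn_integral_substitution_aux)
    show "(?g has_real_derivative ?g' x) (at x)" if "x \<in> {-1..0}" for x
      using that by (auto intro!: derivative_eq_intros simp: power2_eq_square)
    show "continuous_on {- 1..0} ?g'" by (auto intro!: continuous_intros)
  qed auto
  also have "\<dots> = (\<integral>\<^sup>+x. F (?g (0 + (-1) * x)) * ?g' (0 + (-1) * x) * indicator {-1..0} (0 + (-1) * x) \<partial>lborel)"
    by (subst nn_integral_real_affine[where c = "-1" and t = 0]) auto
  also have "\<dots> = (\<integral>\<^sup>+x. F (branch i x) * ennreal (1 / (x + real i + 1)\<^sup>2) * indicator {0..1} x \<partial>lborel)"
    by (intro nn_integral_cong) (auto simp: branch_def indicator_def add_ac)
  finally show ?thesis by (simp add: add.commute)
qed

text \<open>The intervals are the ranges of the branches up to end points. They are open on the left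
  so that each point of (0, 1] lies in exactly one of them, the one whose index is floor (1 / x) -
  1.\<close>

lemma branch_intervals_cover:
  assumes "x \<in> {0<..1}"
  shows "(\<Sum>i. indicator {1 / (real i + 2)<..1 / (real i + 1)} x) = (1 :: ennreal)"
proof -
  define k where "k = nat \<lfloor>1 / x\<rfloor>"
  have "1 \<le> 1 / x" using assms by auto
  then have k: "1 \<le> k" "real k \<le> 1 / x" "1 / x < real k + 1" unfolding k_def by linarith+
  have iff: "x \<in> {1 / (real i + 2)<..1 / (real i + 1)} \<longleftrightarrow> i = k - 1" for i
  proof -
    have "x \<in> {1 / (real i + 2)<..1 / (real i + 1)} \<longleftrightarrow> 1 / x < real i + 2 \<and> real i + 1 \<le> 1 / x"
      using assms by (auto simp: field_simps)
    also have "\<dots> \<longleftrightarrow> i = k - 1" using k by (auto simp: of_nat_diff)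
    finally show ?thesis .
  qed
  have "(\<Sum>i. indicator {1 / (real i + 2)<..1 / (real i + 1)} x) = (\<Sum>i. if i = k - 1 then 1 else 0 :: ennreal)"
    unfolding indicator_def using iff by (intro suminf_cong) (simp only:  of_bool_def)
  also have "\<dots> = 1" using sums_single[of "k - 1" "\<lambda>_. 1 :: ennreal"] by (simp add: sums_iff)
  finally show ?thesis .
qed

text \<open>Substitute \<open>branch i\<close> on the i-th piece of the unit interval. The Gauss
  density at \<open>branch i x\<close> times the Jacobian 1 / (x + i + 1)^2 equals the Gauss density
  at x times \<open>weight i x\<close>.\<close>

lemma nn_integral_gauss_branches:
  assumes [measurable]: "H \<in> borel_measurable borel"
  shows "(\<integral>\<^sup>+x. H x \<partial>gauss_borel) =
    (\<Sum>i. \<integral>\<^sup>+x. ennreal (weight i x) * H (branch i x) \<partial>gauss_borel)"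
proof -
  let ?\<rho> = "\<lambda>x. ennreal (1 / (ln 2 * (1 + x)))"
  let ?J = "\<lambda>i. {1 / (real i + 2)<..1 / (real i + 1)}"
  have ac: "a * h * e = r * (w * h)" if "a * e = r * w" for a h e r w :: ennreal
    using that by (metis mult.assoc mult.commute)
  have sub: "?J i \<subseteq> {0<..1}" for i
  proof
    fix x assume "x \<in> ?J i"
    moreover have "0 < 1 / (real i + 2)" "1 / (real i + 1) \<le> 1" by auto
    ultimately have "0 < x" "x \<le> 1" unfolding greaterThanAtMost_iff by linarith+
    then show "x \<in> {0<..1}" by simp
  qed
  have "(\<integral>\<^sup>+x. H x \<partial>gauss_borel) = (\<integral>\<^sup>+x. ?\<rho> x * H x * indicator {0<..1} x \<partial>lborel)"
    by (rule nn_integral_gauss_borel) fact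
  also have "\<dots> = (\<integral>\<^sup>+x. (\<Sum>i. ?\<rho> x * H x * indicator (?J i) x) \<partial>lborel)"
  proof (rule nn_integral_cong)
    fix x :: real
    show "?\<rho> x * H x * indicator {0<..1} x = (\<Sum>i. ?\<rho> x * H x * indicator (?J i) x)"
    proof (cases "x \<in> {0<..1}")
      case True
      then show ?thesis using branch_intervals_cover[OF True] by simp
    next
      case False
      then have "indicator (?J i) x = (0 :: ennreal)" for i using sub[of i] by (auto simp: indicator_def)
      then show ?thesis using False by simp
    qed
  qed
  also have "\<dots> = (\<Sum>i. \<integral>\<^sup>+x. ?\<rho> x * H x * indicator (?J i) x \<partial>lborel)"
    by (rule nn_integral_suminf) measurable
  also have "(\<lambda>i. \<integral>\<^sup>+x. ?\<rho> x * H x * indicator (?J i) x \<partial>lborel)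
    = (\<lambda>i. \<integral>\<^sup>+x. ennreal (weight i x) * H (branch i x) \<partial>gauss_borel)"
  proof
    fix i :: nat
    \<comment> \<open>The substitution is stated for a closed interval; the added end point is a
      null set.\<close>
    have "(\<integral>\<^sup>+x. ?\<rho> x * H x * indicator (?J i) x \<partial>lborel)
       = (\<integral>\<^sup>+x. ?\<rho> x * H x * indicator {1 / (real i + 2)..1 / (real i + 1)} x \<partial>lborel)"
      by (rule nn_integral_cong_AE, rule eventually_mono[OF AE_lborel_singleton[of "1 / (real i + 2)"]])
        (auto simp: indicator_def)
    also have "\<dots> = (\<integral>\<^sup>+x. ?\<rho> (branch i x) * H (branch i x) * ennreal (1 / (x + real i + 1)\<^sup>2)
        * indicator {0..1} x \<partial>lborel)"
      by (rule nn_integral_branch_interval) measurable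
    also have "\<dots> = (\<integral>\<^sup>+x. ?\<rho> x * (ennreal (weight i x) * H (branch i x)) * indicator {0<..1} x \<partial>lborel)"
    proof (rule nn_integral_cong_AE, rule eventually_mono[OF AE_lborel_singleton[of "0::real"]])
      fix x :: real assume "x \<noteq> 0"
      show "?\<rho> (branch i x) * H (branch i x) * ennreal (1 / (x + real i + 1)\<^sup>2) * indicator {0..1} x
        = ?\<rho> x * (ennreal (weight i x) * H (branch i x)) * indicator {0<..1} x"
      proof (cases "x \<in> {0<..1}")
        case True
        then have p: "0 < x" "0 < x + real i + 1" "0 < x + real i + 2" by auto
        have "1 + branch i x = (x + real i + 2) / (x + real i + 1)"
          using p by (simp add: branch_def field_simps)
        then have "1 / (ln 2 * (1 + branch i x)) * (1 / (x + real i + 1)\<^sup>2) = 1 / (ln 2 * (1 + x)) * weight i x"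
          using p by (simp add: weight_def power2_eq_square add.commute)
        then have "?\<rho> (branch i x) * ennreal (1 / (x + real i + 1)\<^sup>2) = ?\<rho> x * ennreal (weight i x)"
          using p weight_nonneg[of x i] by (simp add: ennreal_mult''[symmetric])
        then have "?\<rho> (branch i x) * H (branch i x) * ennreal (1 / (x + real i + 1)\<^sup>2)
            = ?\<rho> x * (ennreal (weight i x) * H (branch i x))"
          by (rule ac)
        then show ?thesis using True by (simp add: indicator_def)
      qed (use \<open>x \<noteq> 0\<close> in \<open>auto simp: indicator_def\<close>)
    qed
    also have "\<dots> = (\<integral>\<^sup>+x. ennreal (weight i x) * H (branch i x) \<partial>gauss_borel)"
      by (subst nn_integral_gauss_borel) auto
    finally show "(\<integral>\<^sup>+x. ?\<rho> x * H x * indicator (?J i) x \<partial>lborel)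
      = (\<integral>\<^sup>+x. ennreal (weight i x) * H (branch i x) \<partial>gauss_borel)" .
  qed
  finally show ?thesis .
qed

section \<open>Invariance and quasi-independence\<close>

lemma nn_integral_gauss_branches_map:
  assumes [measurable]: "h \<in> borel_measurable borel" "\<phi> \<in> borel_measurable borel"
  shows "(\<integral>\<^sup>+x. h x * \<phi> (gauss_map x) \<partial>gauss_borel) =
    (\<Sum>i. \<integral>\<^sup>+x. ennreal (weight i x) * h (branch i x) * \<phi> x \<partial>gauss_borel)"
proof -
  have "(\<integral>\<^sup>+x. ennreal (weight i x) * (h (branch i x) * \<phi> (gauss_map (branch i x))) \<partial>gauss_borel)
      = (\<integral>\<^sup>+x. ennreal (weight i x) * h (branch i x) * \<phi> x \<partial>gauss_borel)" for i
    by (rule nn_integral_cong_AE, rule eventually_mono[OF AE_irr_unit])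
      (simp add: gauss_map_branch mult.assoc)
  then show ?thesis by (subst nn_integral_gauss_branches) auto
qed

lemma suminf_ennreal_weight:
  assumes "0 \<le> x"
  shows "(\<Sum>i. ennreal (weight i x)) = 1"
  using weight_sums[OF assms] weight_nonneg[OF assms]
  by (subst suminf_ennreal2) (auto simp: sums_iff)

text \<open>Invariance amounts to the weights of all branches summing to 1: branch i contributes
  \<open>weight i x * \<phi> x\<close>.\<close>

lemma nn_integral_gauss_map:
  assumes [measurable]: "\<phi> \<in> borel_measurable borel"
  shows "(\<integral>\<^sup>+x. \<phi> (gauss_map x) \<partial>gauss_borel) = (\<integral>\<^sup>+x. \<phi> x \<partial>gauss_borel)"
proof -
  have "(\<integral>\<^sup>+x. \<phi> (gauss_map x) \<partial>gauss_borel) = (\<Sum>i. \<integral>\<^sup>+x. ennreal (weight i x) * \<phi> x \<partial>gauss_borel)"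
    using nn_integral_gauss_branches_map[of "\<lambda>_. 1" \<phi>] by simp
  also have "\<dots> = (\<integral>\<^sup>+x. (\<Sum>i. ennreal (weight i x)) * \<phi> x \<partial>gauss_borel)"
    by (subst nn_integral_suminf[symmetric]) auto
  also have "\<dots> = (\<integral>\<^sup>+x. \<phi> x \<partial>gauss_borel)"
    by (rule nn_integral_cong_AE, rule eventually_mono[OF AE_irr_unit])
      (simp add: suminf_ennreal_weight irr_unit_def)
  finally show ?thesis .
qed

lemma distr_gauss_map_funpow: "distr gauss_borel borel (gauss_map ^^ k) = gauss_borel"
proof (induction k)
  case 0
  show ?case by (simp add: distr_id2)
next
  case (Suc k)
  have step: "distr gauss_borel borel gauss_map = gauss_borel"
  proof (rule measure_eqI)
    fix A assume "A \<in> sets (distr gauss_borel borel gauss_map)"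
    then have [measurable]: "A \<in> sets borel" by simp
    have "emeasure (distr gauss_borel borel gauss_map) A = (\<integral>\<^sup>+x. indicator A (gauss_map x) \<partial>gauss_borel)"
      by (subst nn_integral_distr[of gauss_map gauss_borel borel "indicator A", symmetric]) auto
    also have "\<dots> = emeasure gauss_borel A" by (subst nn_integral_gauss_map) auto
    finally show "emeasure (distr gauss_borel borel gauss_map) A = emeasure gauss_borel A" .
  qed simp
  have "distr gauss_borel borel (gauss_map ^^ Suc k)
      = distr (distr gauss_borel borel (gauss_map ^^ k)) borel gauss_map"
    by (subst distr_distr) auto
  then show ?case by (simp only: Suc step)
qed

lemma measure_gauss_map_funpow:
  assumes [measurable]: "A \<in> sets borel"
  shows "measure gauss_borel ((gauss_map ^^ k) -` A) = measure gauss_borel A"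
  using measure_distr[of "gauss_map ^^ k" gauss_borel borel A]
  by (simp add: distr_gauss_map_funpow)

lemma integral_gauss_map_funpow:
  fixes \<phi> :: "real \<Rightarrow> real"
  assumes [measurable]: "\<phi> \<in> borel_measurable borel"
  shows "(\<integral>x. \<phi> ((gauss_map ^^ k) x) \<partial>gauss_borel) = (\<integral>x. \<phi> x \<partial>gauss_borel)"
  by (subst integral_distr[of "gauss_map ^^ k" gauss_borel borel, symmetric])
    (auto simp: distr_gauss_map_funpow)

text \<open>The general shape of a product of weights along a word of branches, that is, of the
  conditional probability of a block of digits given the later orbit. On the unit interval,
  \<open>weight i\<close> has the parameters (i + 1, 1, i + 2, 1) and the constant 1 has (1, 1, 1,
  0).\<close>

definition cylinder_weight :: "real \<Rightarrow> real \<Rightarrow> real \<Rightarrow> real \<Rightarrow> real \<Rightarrow> real" where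
  "cylinder_weight a b c d x = (1 + x) / ((a + b * x) * (c + d * x))"

lemma cylinder_weight_measurable [measurable]: "cylinder_weight a b c d \<in> borel_measurable borel"
  unfolding cylinder_weight_def[abs_def] by measurable

text \<open>Pair the factors: (1 + x) / (a + b x) lies between 1 / a and 2 / a, and 1 / (c + d x)
  between 1 / (2 c) and 1 / c. The two lower bounds use b <= a and d <= c. Upper and lower bound
  differ by the factor 4, whatever the parameters are.\<close>

lemma cylinder_weight_bounds:
  assumes "0 \<le> x" "x \<le> 1" "0 < a" "0 \<le> b" "b \<le> a" "0 < c" "0 \<le> d" "d \<le> c"
  shows "1 / (2 * (a * c)) \<le> cylinder_weight a b c d x" "cylinder_weight a b c d x \<le> 2 / (a * c)"
proof -
  have bx: "0 \<le> b * x" "b * x \<le> a * x" and dx: "0 \<le> d * x" "d * x \<le> c"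
    using assms mult_right_mono[of b a x] mult_left_mono[of x 1 d] by auto
  have "(a + b * x) * (c + d * x) \<le> (a * (1 + x)) * (2 * c)"
    using bx dx assms by (intro mult_mono) (auto simp: algebra_simps)
  moreover have pos: "0 < (a + b * x) * (c + d * x)" using bx(1) dx(1) assms by (intro mult_pos_pos) linarith+
  ultimately have "(1 + x) / ((a * (1 + x)) * (2 * c)) \<le> cylinder_weight a b c d x"
    unfolding cylinder_weight_def using assms by (intro frac_le) auto
  moreover have "(1 + x) / ((a * (1 + x)) * (2 * c)) = 1 / (2 * (a * c))"
    using less_add_one[of x] assms by (simp add: divide_simps)
  ultimately show "1 / (2 * (a * c)) \<le> cylinder_weight a b c d x" by simp
  have "a * c \<le> (a + b * x) * (c + d * x)" using bx dx assms by (intro mult_mono) auto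
  then show "cylinder_weight a b c d x \<le> 2 / (a * c)"
    unfolding cylinder_weight_def using assms by (intro frac_le) auto
qed

text \<open>The family is closed under passing to one more digit. The parameters follow the
  recursion of continued fraction denominators: a and c are updated, b and d receive the previous
  values. Hence \<open>b \<le> a\<close> and \<open>d \<le> c\<close> persist.\<close>

lemma weight_mult_cylinder_weight_branch:
  assumes "0 < x" "0 < a" "0 \<le> b" "0 < c" "0 \<le> d"
  shows "weight i x * cylinder_weight a b c d (branch i x)
    = cylinder_weight (a * (real i + 1) + b) a (c * (real i + 1) + d) c x"
proof -
  define n where "n = real i + 1"
  have n: "1 \<le> n" by (simp add: n_def)
  have p: "0 < x + n" "0 < x + n + 1" "0 < a * (x + n) + b" "0 < c * (x + n) + d"
    using assms n by (auto intro!: add_pos_nonneg)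
  have br: "branch i x = 1 / (x + n)" by (simp add: branch_def n_def add_ac)
  have e: "1 + branch i x = (x + n + 1) / (x + n)"
    "a + b * branch i x = (a * (x + n) + b) / (x + n)"
    "c + d * branch i x = (c * (x + n) + d) / (x + n)"
    unfolding br using p by (simp_all add: field_simps)
  have "cylinder_weight a b c d (branch i x) = (x + n + 1) * (x + n) / ((a * (x + n) + b) * (c * (x + n) + d))"
    unfolding cylinder_weight_def e using p by simp
  moreover have "weight i x = (x + 1) / ((x + n) * (x + n + 1))"
    by (simp add: weight_def n_def add_ac)
  ultimately have "weight i x * cylinder_weight a b c d (branch i x)
      = (x + 1) / ((a * (x + n) + b) * (c * (x + n) + d))"
    using p by simp
  then show ?thesis unfolding cylinder_weight_def n_def by (simp add: algebra_simps)
qed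

text \<open>Dependence on the first k digits up to a null set, encoded without a sigma-field:
  membership is constant on each cylinder. The points outside \<open>irr_unit\<close> are exempt
  because the branch formulas may fail there.\<close>

definition digits_determine :: "nat \<Rightarrow> real set \<Rightarrow> bool" where
  "digits_determine k A \<longleftrightarrow>
    (\<forall>x\<in>irr_unit. \<forall>y\<in>irr_unit. (\<forall>j<k. digit j x = digit j y) \<longrightarrow> x \<in> A \<longrightarrow> y \<in> A)"

lemma digits_determine_branch:
  assumes "digits_determine (Suc k) A"
  shows "digits_determine k (branch i -` A)"
  unfolding digits_determine_def
proof (intro ballI impI)
  fix x y assume xy: "x \<in> irr_unit" "y \<in> irr_unit" "\<forall>j<k. digit j x = digit j y" "x \<in> branch i -` A"
  have "digit j (branch i x) = digit j (branch i y)" if "j < Suc k" for j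
    using that xy by (cases j) (auto simp: digit_0_branch digit_Suc_branch)
  then show "y \<in> branch i -` A"
    using assms branch_irr_unit xy unfolding digits_determine_def by (meson vimageE vimageI)
qed

text \<open>The induction treats all cylinder weights at once. Removing the first digit turns a
  weight into another one of the family, and only at k = 0, where A either contains
  \<open>irr_unit\<close> or is disjoint from it, are the largest and the smallest value of the
  weight compared. So the factor 4 is lost once, not once per digit.\<close>

lemma cylinder_weight_quasi_independent:
  assumes "digits_determine k A" and [measurable]: "A \<in> sets borel" "\<phi> \<in> borel_measurable borel"
    and "0 < a" "0 \<le> b" "b \<le> a" "0 < c" "0 \<le> d" "d \<le> c"
  shows "ennreal (1 / 4) * (\<integral>\<^sup>+x. ennreal (cylinder_weight a b c d x) * indicator A x \<partial>gauss_borel)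
      * (\<integral>\<^sup>+x. \<phi> x \<partial>gauss_borel)
    \<le> (\<integral>\<^sup>+x. ennreal (cylinder_weight a b c d x) * indicator A x * \<phi> ((gauss_map ^^ k) x) \<partial>gauss_borel)"
  using assms
proof (induction k arbitrary: A a b c d)
  case 0
  note [measurable] = 0(2,3)
  let ?m = "1 / (2 * (a * c))"
  have bd: "?m \<le> cylinder_weight a b c d x" "cylinder_weight a b c d x \<le> 2 / (a * c)"
    if "x \<in> irr_unit" for x
    using cylinder_weight_bounds[of x a b c d] that 0 by (auto simp: irr_unit_def)
  show ?case
  proof (cases "A \<inter> irr_unit = {}")
    case True
    have "(\<integral>\<^sup>+x. ennreal (cylinder_weight a b c d x) * indicator A x \<partial>gauss_borel) = (\<integral>\<^sup>+x. 0 \<partial>gauss_borel)"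
      by (rule nn_integral_cong_AE, rule eventually_mono[OF AE_irr_unit]) (use True in \<open>auto simp: indicator_def\<close>)
    then show ?thesis by simp
  next
    case False
    then have A: "irr_unit \<subseteq> A" using 0(1) by (auto simp: digits_determine_def)
    have "(\<integral>\<^sup>+x. ennreal (cylinder_weight a b c d x) * indicator A x \<partial>gauss_borel)
        \<le> (\<integral>\<^sup>+x. ennreal (2 / (a * c)) \<partial>gauss_borel)"
      by (rule nn_integral_mono_AE, rule eventually_mono[OF AE_irr_unit])
        (use bd in \<open>auto simp: indicator_def intro!: ennreal_leI\<close>)
    also have "\<dots> = ennreal (2 / (a * c))" using gauss.emeasure_space_1 by simp
    finally have "ennreal (1 / 4) * (\<integral>\<^sup>+x. ennreal (cylinder_weight a b c d x) * indicator A x \<partial>gauss_borel)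
        \<le> ennreal (1 / 4) * ennreal (2 / (a * c))" by (rule mult_left_mono) simp
    also have "\<dots> = ennreal ?m" by (subst ennreal_mult'[symmetric]) auto
    finally have "ennreal (1 / 4) * (\<integral>\<^sup>+x. ennreal (cylinder_weight a b c d x) * indicator A x \<partial>gauss_borel)
        * (\<integral>\<^sup>+x. \<phi> x \<partial>gauss_borel) \<le> ennreal ?m * (\<integral>\<^sup>+x. \<phi> x \<partial>gauss_borel)"
      by (rule mult_right_mono) simp
    also have "\<dots> = (\<integral>\<^sup>+x. ennreal ?m * \<phi> x \<partial>gauss_borel)" by (subst nn_integral_cmult) auto
    also have "\<dots> \<le> (\<integral>\<^sup>+x. ennreal (cylinder_weight a b c d x) * indicator A x * \<phi> ((gauss_map ^^ 0) x) \<partial>gauss_borel)"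
      by (rule nn_integral_mono_AE, rule eventually_mono[OF AE_irr_unit])
        (use bd A in \<open>auto simp: indicator_def intro!: mult_right_mono ennreal_leI\<close>)
    finally show ?thesis .
  qed
next
  case (Suc k)
  note [measurable] = Suc.prems(2,3)
  let ?W = "\<lambda>i. cylinder_weight (a * (real i + 1) + b) a (c * (real i + 1) + d) c"
  let ?A = "\<lambda>i. branch i -` A"
  have [measurable]: "?A i \<in> sets borel" for i
    using measurable_sets[OF branch_measurable Suc.prems(2)] by simp
  have W: "ennreal (weight i x) * (ennreal (cylinder_weight a b c d (branch i x)) * e) = ennreal (?W i x) * e"
    if "x \<in> irr_unit" for i x e
    using that Suc.prems weight_nonneg[of x i] weight_mult_cylinder_weight_branch[of x a b c d i]
    by (simp add: irr_unit_def mult.assoc[symmetric] ennreal_mult'[symmetric])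
  have IH: "ennreal (1 / 4) * (\<integral>\<^sup>+x. ennreal (?W i x) * indicator (?A i) x \<partial>gauss_borel) * (\<integral>\<^sup>+x. \<phi> x \<partial>gauss_borel)
    \<le> (\<integral>\<^sup>+x. ennreal (?W i x) * indicator (?A i) x * \<phi> ((gauss_map ^^ k) x) \<partial>gauss_borel)" for i
  proof (rule Suc.IH)
    show "digits_determine k (?A i)" by (rule digits_determine_branch) fact
    show "0 < a * (real i + 1) + b" "0 < c * (real i + 1) + d"
      using Suc.prems mult_pos_pos[of _ "real i + 1"] by (simp_all add: add_pos_nonneg)
    show "a \<le> a * (real i + 1) + b" "c \<le> c * (real i + 1) + d"
      using Suc.prems by (auto simp: algebra_simps)
  qed (use Suc.prems in auto)
  have 1: "(\<integral>\<^sup>+x. ennreal (cylinder_weight a b c d x) * indicator A x \<partial>gauss_borel)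
     = (\<Sum>i. \<integral>\<^sup>+x. ennreal (?W i x) * indicator (?A i) x \<partial>gauss_borel)"
  proof (subst nn_integral_gauss_branches, measurable, intro suminf_cong)
    fix i
    show "(\<integral>\<^sup>+x. ennreal (weight i x) * (ennreal (cylinder_weight a b c d (branch i x)) * indicator A (branch i x)) \<partial>gauss_borel)
      = (\<integral>\<^sup>+x. ennreal (?W i x) * indicator (?A i) x \<partial>gauss_borel)"
      by (rule nn_integral_cong_AE, rule eventually_mono[OF AE_irr_unit])
        (simp only: W, simp add: indicator_def)
  qed
  have 2: "(\<integral>\<^sup>+x. ennreal (cylinder_weight a b c d x) * indicator A x * \<phi> ((gauss_map ^^ Suc k) x) \<partial>gauss_borel)
     = (\<Sum>i. \<integral>\<^sup>+x. ennreal (?W i x) * indicator (?A i) x * \<phi> ((gauss_map ^^ k) x) \<partial>gauss_borel)"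
  proof -
    have "(\<integral>\<^sup>+x. ennreal (cylinder_weight a b c d x) * indicator A x * \<phi> ((gauss_map ^^ Suc k) x) \<partial>gauss_borel)
      = (\<integral>\<^sup>+x. ennreal (cylinder_weight a b c d x) * indicator A x * (\<lambda>x. \<phi> ((gauss_map ^^ k) x)) (gauss_map x) \<partial>gauss_borel)"
      by (simp add: funpow_swap1)
    also have "\<dots> = (\<Sum>i. \<integral>\<^sup>+x. ennreal (weight i x) * (ennreal (cylinder_weight a b c d (branch i x)) * indicator A (branch i x))
        * \<phi> ((gauss_map ^^ k) x) \<partial>gauss_borel)"
      by (rule nn_integral_gauss_branches_map) measurable
    also have "\<dots> = (\<Sum>i. \<integral>\<^sup>+x. ennreal (?W i x) * indicator (?A i) x * \<phi> ((gauss_map ^^ k) x) \<partial>gauss_borel)"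
      by (intro suminf_cong nn_integral_cong_AE, rule eventually_mono[OF AE_irr_unit])
        (simp only: W, simp add: indicator_def)
    finally show ?thesis .
  qed
  show ?case unfolding 1 2
    by (subst ennreal_suminf_cmult[symmetric], subst ennreal_suminf_multc[symmetric])
      (intro suminf_le IH, auto)
qed

lemma gauss_quasi_independent:
  assumes "digits_determine k A" and [measurable]: "A \<in> sets borel" "B \<in> sets borel"
  shows "measure gauss_borel A * measure gauss_borel B / 4
    \<le> measure gauss_borel (A \<inter> (gauss_map ^^ k) -` B)"
proof -
  \<comment> \<open>These parameters give the constant 1, so the weighted integrals become
    probabilities.\<close>
  have one: "ennreal (cylinder_weight 1 1 1 0 x) = 1" if "x \<in> irr_unit" for x
    using that by (simp add: cylinder_weight_def irr_unit_def)
  have e: "(\<integral>\<^sup>+x. ennreal (cylinder_weight 1 1 1 0 x) * f x \<partial>gauss_borel) = (\<integral>\<^sup>+x. f x \<partial>gauss_borel)" for f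
    by (rule nn_integral_cong_AE, rule eventually_mono[OF AE_irr_unit]) (simp add: one)
  have [measurable]: "(gauss_map ^^ k) -` B \<in> sets borel"
    using measurable_sets[OF gauss_map_funpow_measurable assms(3)] by simp
  have "ennreal (1 / 4) * emeasure gauss_borel A * emeasure gauss_borel B
      \<le> (\<integral>\<^sup>+x. indicator A x * indicator B ((gauss_map ^^ k) x) \<partial>gauss_borel)"
    using cylinder_weight_quasi_independent[OF assms(1,2), of "indicator B" 1 1 1 0]
    by (simp add: e mult.assoc)
  also have "(\<lambda>x. indicator A x * indicator B ((gauss_map ^^ k) x) :: ennreal)
      = indicator (A \<inter> (gauss_map ^^ k) -` B)"
    by (auto simp: indicator_def)
  also have "(\<integral>\<^sup>+x. indicator (A \<inter> (gauss_map ^^ k) -` B) x \<partial>gauss_borel)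
      = emeasure gauss_borel (A \<inter> (gauss_map ^^ k) -` B)"
    by (rule nn_integral_indicator) simp
  finally show ?thesis
    by (simp add: gauss.emeasure_eq_measure ennreal_mult'[symmetric])
qed

section \<open>Contraction of Lipschitz constants and mixing\<close>

text \<open>The order in i is essential: it matches the lower bound in
  \<open>weight_lower_bound\<close>, so that mixing errors will be relative to the probability of
  the digit.\<close>

lemma weight_lipschitz:
  assumes "0 \<le> x" "x \<le> 1" "0 \<le> y" "y \<le> 1"
  shows "\<bar>weight i x - weight i y\<bar> \<le> 2 / ((real i + 1) * (real i + 2)) * \<bar>x - y\<bar>"
proof -
  define n where "n = real i + 1"
  have n: "1 \<le> n" by (simp add: n_def)
  define N where "N = n * (n + 1)"
  have n2: "n \<le> n * n" using n mult_left_mono[of 1 n n] by simp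
  have Ne: "N = n * n + n" by (simp add: N_def algebra_simps)
  then have N: "0 < N" "2 \<le> N" using n n2 by linarith+
  define X where "X = (x + n) * (x + n + 1)"
  define Y where "Y = (y + n) * (y + n + 1)"
  have X: "N \<le> X" and Y: "N \<le> Y"
    unfolding N_def X_def Y_def using assms n by (auto intro!: mult_mono)
  have w: "weight i x = (x + 1) / X" "weight i y = (y + 1) / Y"
    by (simp_all add: weight_def X_def Y_def n_def add_ac)
  let ?b = "N - x * y - (x + y) - (2 * n + 1)"
  have xy: "0 \<le> x * y" "x * y \<le> 1" using assms mult_le_one[of x y] by auto
  have b: "\<bar>?b\<bar> \<le> 2 * N"
  proof -
    have "\<bar>m + n - p - (x + y) - (2 * n + 1)\<bar> \<le> 2 * (m + n)" if "0 \<le> p" "p \<le> 1" "n \<le> m" for m p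
    proof (rule abs_leI)
      show "m + n - p - (x + y) - (2 * n + 1) \<le> 2 * (m + n)" using that assms n by (simp add: algebra_simps)
      show "- (m + n - p - (x + y) - (2 * n + 1)) \<le> 2 * (m + n)" using that assms n by (simp add: algebra_simps)
    qed
    from this[OF xy n2] show ?thesis by (simp only: Ne)
  qed
  \<comment> \<open>After cross-multiplication the numerator splits off x - y. The cofactor is at
    most 2 N and both denominators are at least N, whence the constant 2 / N.\<close>
  have "(x + 1) * Y - (y + 1) * X = (x - y) * ?b"
    unfolding X_def Y_def N_def by algebra
  then have "weight i x - weight i y = (x - y) * ?b / (X * Y)"
    unfolding w using X Y N by (simp add: divide_simps)
  then have "\<bar>weight i x - weight i y\<bar> = \<bar>x - y\<bar> * \<bar>?b\<bar> / (X * Y)"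
    using X Y N by (simp add: abs_mult)
  also have "\<dots> \<le> \<bar>x - y\<bar> * (2 * N) / (N * N)"
    using X Y N b by (intro frac_le mult_left_mono mult_mono) auto
  also have "\<dots> = 2 / N * \<bar>x - y\<bar>" using N by simp
  finally show ?thesis by (simp add: N_def n_def add_ac)
qed

lemma weight_lower_bound:
  assumes "0 \<le> x" "x \<le> 1"
  shows "1 / (2 * ((real i + 1) * (real i + 2))) \<le> weight i x"
proof -
  have "weight i x = cylinder_weight (real i + 1) 1 (real i + 2) 1 x"
    by (simp add: weight_def cylinder_weight_def add_ac)
  then show ?thesis using cylinder_weight_bounds(1)[of x "real i + 1" 1 "real i + 2" 1] assms by simp
qed

section \<open>Lipschitz contraction under the transfer operator\<close>

lemma branch_mem: "0 \<le> x \<Longrightarrow> x \<le> 1 \<Longrightarrow> 0 \<le> branch i x \<and> branch i x \<le> 1"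
  by (simp add: branch_def)

lemma branch_diff:
  assumes "0 \<le> x" "0 \<le> y"
  shows "\<bar>branch i x - branch i y\<bar> \<le> \<bar>x - y\<bar> / (real i + 1)\<^sup>2"
proof -
  have p: "0 < x + real i + 1" "0 < y + real i + 1" using assms by auto
  then have "branch i x - branch i y = (y - x) / ((x + real i + 1) * (y + real i + 1))"
    unfolding branch_def by (simp add: divide_simps)
  then have "\<bar>branch i x - branch i y\<bar> = \<bar>x - y\<bar> / ((x + real i + 1) * (y + real i + 1))"
    using p by (simp add: abs_mult abs_minus_commute)
  also have "\<dots> \<le> \<bar>x - y\<bar> / ((real i + 1) * (real i + 1))"
    using assms by (intro divide_left_mono mult_mono) auto
  finally show ?thesis by (simp add: power2_eq_square)
qed

text \<open>Summation by parts. \<open>D n\<close> is the difference of the partial sums of the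
  weights at x and y; as both total 1, it tends to 0. What remains are differences of g at
  neighbouring indices, which a Lipschitz bound on h controls when g i is the value of h on branch
  i.\<close>

lemma sum_weight_abel:
  fixes g :: "nat \<Rightarrow> real"
  assumes "0 \<le> x" "0 \<le> y"
  defines "D \<equiv> \<lambda>n. real n / (x + real n + 1) - real n / (y + real n + 1)"
  shows "(\<Sum>i<n. (weight i x - weight i y) * g i) = D n * g n + (\<Sum>i<n. D (Suc i) * (g i - g (Suc i)))"
proof (induction n)
  case (Suc n)
  have "D (Suc n) - D n = weight n x - weight n y"
    using sum_weight[OF assms(1)] sum_weight[OF assms(2)] unfolding D_def
    by (simp only: sum_weight[symmetric] assms(1,2)) simp
  then have "(weight n x - weight n y) * g n = (D (Suc n) - D n) * g n" by simp
  then show ?case using Suc by (simp add: algebra_simps)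
qed (simp add: D_def)

lemma sum_inverse_cubes_bound:
  "(\<Sum>i<n. 1 / ((real i + 1) * (real i + 2) * (real i + 3))) \<le> 1 / 4"
proof -
  have "(\<Sum>i<n. 1 / ((real i + 1) * (real i + 2) * (real i + 3)))
      = 1 / 4 - 1 / (2 * ((real n + 1) * (real n + 2)))"
  proof (induction n)
    case (Suc n)
    have p: "0 < real n + 1" "0 < real n + 2" "0 < real n + 3" by auto
    have "1 / ((real n + 1) * (real n + 2) * (real n + 3))
      = 1 / (2 * ((real n + 1) * (real n + 2))) - 1 / (2 * ((real n + 2) * (real n + 3)))"
      using p by (simp add: divide_simps)
    then show ?case using Suc by (simp add: add_ac)
  qed simp
  also have "\<dots> \<le> 1 / 4" by simp
  finally show ?thesis .
qed

text \<open>The transfer operator of the Gauss map with respect to its invariant measure, adjoint to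
  composition with \<open>gauss_map\<close> by \<open>nn_integral_gauss_operator\<close>.\<close>

definition gauss_operator :: "(real \<Rightarrow> real) \<Rightarrow> real \<Rightarrow> real" where
  "gauss_operator h x = (\<Sum>i. weight i x * h (branch i x))"

definition unit_lipschitz :: "real \<Rightarrow> (real \<Rightarrow> real) \<Rightarrow> bool" where
  "unit_lipschitz s h \<longleftrightarrow> 0 \<le> s \<and> (\<forall>x\<in>{0..1}. \<forall>y\<in>{0..1}. \<bar>h x - h y\<bar> \<le> s * \<bar>x - y\<bar>)"

lemma unit_lipschitzD:
  assumes "unit_lipschitz s h" "0 \<le> x" "x \<le> 1" "0 \<le> y" "y \<le> 1"
  shows "\<bar>h x - h y\<bar> \<le> s * \<bar>x - y\<bar>"
  using assms by (auto simp: unit_lipschitz_def)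

lemma unit_lipschitz_bound:
  assumes "unit_lipschitz s h" "0 \<le> x" "x \<le> 1"
  shows "\<bar>h x\<bar> \<le> \<bar>h 0\<bar> + s"
proof -
  have "\<bar>h x - h 0\<bar> \<le> s * \<bar>x - 0\<bar>" using assms by (intro unit_lipschitzD) auto
  also have "\<dots> \<le> s * 1" using assms by (intro mult_left_mono) (auto simp: unit_lipschitz_def)
  finally show ?thesis by simp
qed

lemma gauss_operator_sums:
  assumes "unit_lipschitz s h" "0 \<le> x" "x \<le> 1"
  shows "(\<lambda>i. weight i x * h (branch i x)) sums gauss_operator h x"
proof -
  have "summable (\<lambda>i. weight i x * (\<bar>h 0\<bar> + s))"
    using weight_sums[OF assms(2)] by (intro summable_mult2) (simp add: sums_iff)
  moreover have "norm (weight i x * h (branch i x)) \<le> weight i x * (\<bar>h 0\<bar> + s)" for i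
    using unit_lipschitz_bound[OF assms(1), of "branch i x"] branch_mem[OF assms(2,3)] weight_nonneg[OF assms(2)]
    by (auto simp: abs_mult intro!: mult_left_mono)
  ultimately have "summable (\<lambda>i. weight i x * h (branch i x))"
    by (rule summable_comparison_test'[where N = 0])
  then show ?thesis by (simp add: gauss_operator_def summable_sums)
qed

text \<open>Passing from x to y changes the arguments of h and the weights. The first effect costs
  5/8 of s |x - y|, the second 1/4 of it after summation by parts; together 7/8. The last summand is
  the boundary term, which vanishes as n grows.\<close>

lemma partial_gauss_operator_diff:
  assumes h: "unit_lipschitz s h" and x: "0 \<le> x" "x \<le> 1" and y: "0 \<le> y" "y \<le> 1"
  shows "\<bar>(\<Sum>i<n. weight i x * h (branch i x)) - (\<Sum>i<n. weight i y * h (branch i y))\<bar>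
    \<le> 7 / 8 * s * \<bar>x - y\<bar> + (\<bar>h 0\<bar> + s) * \<bar>x - y\<bar> / (real n + 1)"
proof -
  define e where "e = \<bar>x - y\<bar>"
  define K where "K = \<bar>h 0\<bar> + s"
  define D where "D = (\<lambda>n. real n / (x + real n + 1) - real n / (y + real n + 1))"
  let ?g = "\<lambda>i. h (branch i y)"
  have s: "0 \<le> s" and e: "0 \<le> e" using h by (auto simp: unit_lipschitz_def e_def)
  have D: "\<bar>D m\<bar> \<le> e * real m / (real m + 1)\<^sup>2" for m
  proof -
    have "D m = real m * (branch m x - branch m y)" by (simp add: D_def branch_def algebra_simps)
    then have "\<bar>D m\<bar> = real m * \<bar>branch m x - branch m y\<bar>" by (simp add: abs_mult)
    also have "\<dots> \<le> real m * (e / (real m + 1)\<^sup>2)"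
      unfolding e_def using branch_diff[OF x(1) y(1)] by (intro mult_left_mono) auto
    finally show ?thesis by (simp add: mult.commute)
  qed
  \<comment> \<open>Branch i contracts by 1 / (i + 1)^2, which is at most 1/4 except for i = 0,
    where it is 1. The excess 3/4 at i = 0 is multiplied by \<open>weight 0 x \<le> 1 / 2\<close>,
    so the total is 1/4 + 3/8 = 5/8.\<close>
  have "\<bar>\<Sum>i<n. weight i x * (h (branch i x) - ?g i)\<bar>
      \<le> (\<Sum>i<n. (1 / 4 * weight i x + (if i = 0 then 3 / 8 else 0)) * (s * e))"
  proof (rule order_trans[OF sum_abs], rule sum_mono)
    fix i
    have "\<bar>h (branch i x) - ?g i\<bar> \<le> s * \<bar>branch i x - branch i y\<bar>"
      using branch_mem[of x i] branch_mem[of y i] x y by (intro unit_lipschitzD[OF h]) auto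
    also have "\<dots> \<le> s * (e / (real i + 1)\<^sup>2)"
      unfolding e_def using s x y by (intro mult_left_mono branch_diff) auto
    finally have "weight i x * \<bar>h (branch i x) - ?g i\<bar> \<le> weight i x * (s * (e / (real i + 1)\<^sup>2))"
      using weight_nonneg[OF x(1), of i] by (rule mult_left_mono)
    then have "\<bar>weight i x * (h (branch i x) - ?g i)\<bar> \<le> weight i x * (s * (e / (real i + 1)\<^sup>2))"
      using weight_nonneg[OF x(1), of i] by (simp only: abs_mult abs_of_nonneg)
    also have "\<dots> = weight i x / (real i + 1)\<^sup>2 * (s * e)" by simp
    also have "\<dots> \<le> (1 / 4 * weight i x + (if i = 0 then 3 / 8 else 0)) * (s * e)"
    proof (rule mult_right_mono)
      show "weight i x / (real i + 1)\<^sup>2 \<le> 1 / 4 * weight i x + (if i = 0 then 3 / 8 else 0)"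
      proof (cases "i = 0")
        case True
        have "weight 0 x \<le> 1 / 2" using x by (simp add: weight_def divide_simps)
        then show ?thesis using True by simp
      next
        case False
        then have "2\<^sup>2 \<le> (real i + 1)\<^sup>2" by (intro power_mono) auto
        then have "weight i x / (real i + 1)\<^sup>2 \<le> weight i x / 4"
          using weight_nonneg[OF x(1), of i] by (intro divide_left_mono) auto
        then show ?thesis using False by simp
      qed
    qed (use s e in auto)
    finally show "\<bar>weight i x * (h (branch i x) - ?g i)\<bar>
      \<le> (1 / 4 * weight i x + (if i = 0 then 3 / 8 else 0)) * (s * e)" .
  qed
  also have "\<dots> = (1 / 4 * (\<Sum>i<n. weight i x) + (\<Sum>i<n. if i = 0 then 3 / 8 else 0)) * (s * e)"
    by (simp only: sum_distrib_right[symmetric] sum.distrib sum_distrib_left[symmetric])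
  also have "\<dots> \<le> 5 / 8 * (s * e)"
  proof (rule mult_right_mono)
    have "(\<Sum>i<n. weight i x) \<le> 1" using x by (simp add: sum_weight)
    moreover have "(\<Sum>i<n. if i = 0 then 3 / 8 else 0 :: real) \<le> 3 / 8" by (simp add: sum.delta)
    ultimately show "1 / 4 * (\<Sum>i<n. weight i x) + (\<Sum>i<n. if i = 0 then 3 / 8 else 0) \<le> 5 / 8" by simp
  qed (use s e in auto)
  finally have 1: "\<bar>\<Sum>i<n. weight i x * (h (branch i x) - ?g i)\<bar> \<le> 5 / 8 * (s * e)" .
  \<comment> \<open>\<open>D (Suc i)\<close> is at most |x - y| / (i + 3) and neighbouring branches
    differ by at most 1 / ((i + 1) (i + 2)). The products of these bounds form a telescoping series
    with sum 1/4.\<close>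
  have "\<bar>\<Sum>i<n. D (Suc i) * (?g i - ?g (Suc i))\<bar>
      \<le> (\<Sum>i<n. (s * e) * (1 / ((real i + 1) * (real i + 2) * (real i + 3))))"
  proof (rule order_trans[OF sum_abs], rule sum_mono)
    fix i
    have p: "0 < y + real i + 1" "0 < y + real i + 2" using y by auto
    have "branch i y - branch (Suc i) y = 1 / ((y + real i + 1) * (y + real i + 2))"
      unfolding branch_def using p by (simp add: divide_simps)
    also have "\<dots> \<le> 1 / ((real i + 1) * (real i + 2))"
      using y by (intro divide_left_mono mult_mono) auto
    finally have b: "branch i y - branch (Suc i) y \<le> 1 / ((real i + 1) * (real i + 2))" .
    have "0 \<le> branch i y - branch (Suc i) y" using p by (simp add: branch_def frac_le)
    then have "s * \<bar>branch i y - branch (Suc i) y\<bar> \<le> s * (1 / ((real i + 1) * (real i + 2)))"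
      using b s by (intro mult_left_mono) auto
    moreover have "\<bar>?g i - ?g (Suc i)\<bar> \<le> s * \<bar>branch i y - branch (Suc i) y\<bar>"
      using branch_mem[of y i] branch_mem[of y "Suc i"] y by (intro unit_lipschitzD[OF h]) auto
    ultimately have g: "\<bar>?g i - ?g (Suc i)\<bar> \<le> s * (1 / ((real i + 1) * (real i + 2)))" by linarith
    have "\<bar>D (Suc i)\<bar> \<le> e * (real i + 1) / ((real i + 2) * (real i + 2))"
      using D[of "Suc i"] by (simp add: power2_eq_square add_ac)
    also have "\<dots> \<le> e * (1 / (real i + 3))"
    proof -
      have "(real i + 1) * (real i + 3) \<le> (real i + 2) * (real i + 2)" by (simp add: algebra_simps)
      then have "(real i + 1) / ((real i + 2) * (real i + 2)) \<le> 1 / (real i + 3)"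
        by (subst pos_divide_le_eq) (auto simp: pos_le_divide_eq)
      from mult_left_mono[OF this e] show ?thesis by simp
    qed
    also have "\<dots> = e / (real i + 3)" by simp
    finally have d: "\<bar>D (Suc i)\<bar> \<le> e / (real i + 3)" .
    have "\<bar>D (Suc i) * (?g i - ?g (Suc i))\<bar> \<le> e / (real i + 3) * (s * (1 / ((real i + 1) * (real i + 2))))"
      unfolding abs_mult using d g s e by (intro mult_mono) auto
    also have "\<dots> = (s * e) * (1 / ((real i + 1) * (real i + 2) * (real i + 3)))"
      by (simp add: mult.commute)
    finally show "\<bar>D (Suc i) * (?g i - ?g (Suc i))\<bar>
      \<le> (s * e) * (1 / ((real i + 1) * (real i + 2) * (real i + 3)))" .
  qed
  also have "\<dots> \<le> (s * e) * (1 / 4)"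
    unfolding sum_distrib_left[symmetric] using s e by (intro mult_left_mono sum_inverse_cubes_bound) auto
  finally have 2: "\<bar>\<Sum>i<n. D (Suc i) * (?g i - ?g (Suc i))\<bar> \<le> 1 / 4 * (s * e)" by simp
  have 3: "\<bar>D n * ?g n\<bar> \<le> K * e / (real n + 1)"
  proof -
    have "real n / (real n + 1)\<^sup>2 \<le> 1 / (real n + 1)" by (simp add: divide_simps power2_eq_square)
    from mult_left_mono[OF this e] have "\<bar>D n\<bar> \<le> e / (real n + 1)" using D[of n] by simp
    moreover have "\<bar>?g n\<bar> \<le> K"
      unfolding K_def using branch_mem[of y n] y by (intro unit_lipschitz_bound[OF h]) auto
    ultimately have "\<bar>D n * ?g n\<bar> \<le> e / (real n + 1) * K"
      unfolding abs_mult using e by (intro mult_mono) auto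
    then show ?thesis by (simp add: mult.commute)
  qed
  have "(\<Sum>i<n. weight i x * h (branch i x)) - (\<Sum>i<n. weight i y * h (branch i y))
    = (\<Sum>i<n. weight i x * (h (branch i x) - ?g i)) + (\<Sum>i<n. (weight i x - weight i y) * ?g i)"
    by (simp add: sum_subtractf[symmetric] sum.distrib[symmetric] algebra_simps)
  also have "(\<Sum>i<n. (weight i x - weight i y) * ?g i)
    = D n * ?g n + (\<Sum>i<n. D (Suc i) * (?g i - ?g (Suc i)))"
    using sum_weight_abel[OF x(1) y(1)] by (simp only: D_def)
  finally show ?thesis using 1 2 3 unfolding e_def[symmetric] K_def[symmetric] by linarith
qed

lemma unit_lipschitz_gauss_operator:
  assumes h: "unit_lipschitz s h"
  shows "unit_lipschitz (7 / 8 * s) (gauss_operator h)"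
  unfolding unit_lipschitz_def
proof (intro conjI ballI)
  show "0 \<le> 7 / 8 * s" using h by (simp add: unit_lipschitz_def)
  fix x y :: real assume "x \<in> {0..1}" "y \<in> {0..1}"
  then have xy: "0 \<le> x" "x \<le> 1" "0 \<le> y" "y \<le> 1" by auto
  let ?S = "\<lambda>x n. \<Sum>i<n. weight i x * h (branch i x)"
  have "(\<lambda>n. 7 / 8 * s * \<bar>x - y\<bar> + ((\<bar>h 0\<bar> + s) * \<bar>x - y\<bar>) * (1 / (real n + 1)))
      \<longlonglongrightarrow> 7 / 8 * s * \<bar>x - y\<bar> + ((\<bar>h 0\<bar> + s) * \<bar>x - y\<bar>) * 0"
    using LIMSEQ_Suc[OF lim_1_over_n] by (intro tendsto_intros) (simp add: add.commute)
  moreover have "(\<lambda>n. \<bar>?S x n - ?S y n\<bar>) \<longlonglongrightarrow> \<bar>gauss_operator h x - gauss_operator h y\<bar>"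
    using gauss_operator_sums[OF h] xy by (intro tendsto_intros) (auto simp: sums_def)
  moreover have "\<bar>?S x n - ?S y n\<bar> \<le> 7 / 8 * s * \<bar>x - y\<bar> + ((\<bar>h 0\<bar> + s) * \<bar>x - y\<bar>) * (1 / (real n + 1))" for n
    using partial_gauss_operator_diff[OF h xy] by simp
  ultimately have "\<bar>gauss_operator h x - gauss_operator h y\<bar>
      \<le> 7 / 8 * s * \<bar>x - y\<bar> + ((\<bar>h 0\<bar> + s) * \<bar>x - y\<bar>) * 0"
    using LIMSEQ_le by blast
  then show "\<bar>gauss_operator h x - gauss_operator h y\<bar> \<le> 7 / 8 * s * \<bar>x - y\<bar>" by simp
qed

lemma gauss_operator_measurable [measurable]:
  assumes [measurable]: "h \<in> borel_measurable borel"
  shows "gauss_operator h \<in> borel_measurable borel"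
  unfolding gauss_operator_def[abs_def] by measurable

lemma gauss_operator_nonneg:
  assumes "unit_lipschitz s h" "\<And>x. 0 \<le> x \<Longrightarrow> x \<le> 1 \<Longrightarrow> 0 \<le> h x" "0 \<le> x" "x \<le> 1"
  shows "0 \<le> gauss_operator h x"
  using gauss_operator_sums[OF assms(1,3,4)] branch_mem[OF assms(3,4)] assms weight_nonneg[OF assms(3)]
  unfolding gauss_operator_def by (intro suminf_nonneg) (auto simp: sums_iff)

lemma nn_integral_gauss_operator:
  assumes [measurable]: "h \<in> borel_measurable borel" "\<phi> \<in> borel_measurable borel"
    and "unit_lipschitz s h" "\<And>x. 0 \<le> x \<Longrightarrow> x \<le> 1 \<Longrightarrow> 0 \<le> h x"
  shows "(\<integral>\<^sup>+x. ennreal (h x) * \<phi> (gauss_map x) \<partial>gauss_borel)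
    = (\<integral>\<^sup>+x. ennreal (gauss_operator h x) * \<phi> x \<partial>gauss_borel)"
proof -
  have "(\<integral>\<^sup>+x. ennreal (h x) * \<phi> (gauss_map x) \<partial>gauss_borel)
      = (\<integral>\<^sup>+x. (\<Sum>i. ennreal (weight i x) * ennreal (h (branch i x)) * \<phi> x) \<partial>gauss_borel)"
    by (subst nn_integral_suminf, measurable) (rule nn_integral_gauss_branches_map, measurable)
  also have "\<dots> = (\<integral>\<^sup>+x. ennreal (gauss_operator h x) * \<phi> x \<partial>gauss_borel)"
  proof (rule nn_integral_cong_AE, rule eventually_mono[OF AE_irr_unit])
    fix x assume "x \<in> irr_unit"
    then have x: "0 \<le> x" "x \<le> 1" by (auto simp: irr_unit_def)
    have "(\<Sum>i. ennreal (weight i x) * ennreal (h (branch i x))) = (\<Sum>i. ennreal (weight i x * h (branch i x)))"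
      using x assms(4) branch_mem[OF x] weight_nonneg[OF x(1)] by (simp add: ennreal_mult')
    also have "\<dots> = ennreal (gauss_operator h x)"
      unfolding gauss_operator_def
      using gauss_operator_sums[OF assms(3) x] assms(4) branch_mem[OF x] weight_nonneg[OF x(1)]
      by (intro suminf_ennreal2) (auto simp: sums_iff)
    finally show "(\<Sum>i. ennreal (weight i x) * ennreal (h (branch i x)) * \<phi> x) = ennreal (gauss_operator h x) * \<phi> x"
      by simp
  qed
  finally show ?thesis .
qed

text \<open>Each step moves one \<open>gauss_map\<close> from \<phi> to the transfer operator acting
  on h, which preserves the mean of h and shrinks its Lipschitz constant by 7/8. At k = 0, h exceeds
  its mean by at most s because the unit interval has length 1.\<close>

lemma nn_integral_lipschitz_funpow_le:
  assumes "h \<in> borel_measurable borel" and [measurable]: "\<phi> \<in> borel_measurable borel"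
    and "unit_lipschitz s h" "\<And>x. 0 \<le> x \<Longrightarrow> x \<le> 1 \<Longrightarrow> 0 \<le> h x"
  shows "(\<integral>\<^sup>+x. ennreal (h x) * \<phi> ((gauss_map ^^ k) x) \<partial>gauss_borel)
    \<le> ((\<integral>\<^sup>+x. ennreal (h x) \<partial>gauss_borel) + ennreal (s * (7 / 8) ^ k)) * (\<integral>\<^sup>+x. \<phi> x \<partial>gauss_borel)"
  using assms(1,3,4)
proof (induction k arbitrary: h s)
  case 0
  note [measurable] = 0(1)
  have "ennreal (h x) \<le> (\<integral>\<^sup>+x. ennreal (h x) \<partial>gauss_borel) + ennreal s" if x: "x \<in> irr_unit" for x
  proof -
    have "ennreal (h x) = (\<integral>\<^sup>+y. ennreal (h x) \<partial>gauss_borel)" using gauss.emeasure_space_1 by simp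
    also have "\<dots> \<le> (\<integral>\<^sup>+y. ennreal (h y) + ennreal s \<partial>gauss_borel)"
    proof (rule nn_integral_mono_AE, rule eventually_mono[OF AE_irr_unit])
      fix y assume "y \<in> irr_unit"
      then have xy: "0 \<le> x" "x \<le> 1" "0 \<le> y" "y \<le> 1" using x by (auto simp: irr_unit_def)
      have s: "0 \<le> s" using 0 by (simp add: unit_lipschitz_def)
      have "\<bar>h x - h y\<bar> \<le> s * \<bar>x - y\<bar>" by (rule unit_lipschitzD[OF 0(2) xy])
      also have "\<dots> \<le> s * 1" using xy s by (intro mult_left_mono) auto
      finally have "h x \<le> h y + s" by linarith
      then show "ennreal (h x) \<le> ennreal (h y) + ennreal s"
        using s 0(3) xy by (simp flip: ennreal_plus)
    qed
    also have "\<dots> = (\<integral>\<^sup>+x. ennreal (h x) \<partial>gauss_borel) + ennreal s"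
      using gauss.emeasure_space_1 by (subst nn_integral_add) auto
    finally show ?thesis .
  qed
  then have "(\<integral>\<^sup>+x. ennreal (h x) * \<phi> ((gauss_map ^^ 0) x) \<partial>gauss_borel)
    \<le> (\<integral>\<^sup>+x. ((\<integral>\<^sup>+x. ennreal (h x) \<partial>gauss_borel) + ennreal s) * \<phi> x \<partial>gauss_borel)"
    by (intro nn_integral_mono_AE, intro eventually_mono[OF AE_irr_unit]) (auto intro!: mult_right_mono)
  also have "\<dots> = ((\<integral>\<^sup>+x. ennreal (h x) \<partial>gauss_borel) + ennreal s) * (\<integral>\<^sup>+x. \<phi> x \<partial>gauss_borel)"
    by (rule nn_integral_cmult) simp
  finally show ?case by simp
next
  case (Suc k)
  note [measurable] = Suc.prems(1)
  have "(\<integral>\<^sup>+x. ennreal (h x) * \<phi> ((gauss_map ^^ Suc k) x) \<partial>gauss_borel)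
    = (\<integral>\<^sup>+x. ennreal (h x) * (\<lambda>x. \<phi> ((gauss_map ^^ k) x)) (gauss_map x) \<partial>gauss_borel)"
    by (simp add: funpow_swap1)
  also have "\<dots> = (\<integral>\<^sup>+x. ennreal (gauss_operator h x) * \<phi> ((gauss_map ^^ k) x) \<partial>gauss_borel)"
    by (rule nn_integral_gauss_operator[OF _ _ Suc.prems(2,3)]) measurable
  also have "\<dots> \<le> ((\<integral>\<^sup>+x. ennreal (gauss_operator h x) \<partial>gauss_borel) + ennreal (7 / 8 * s * (7 / 8) ^ k))
      * (\<integral>\<^sup>+x. \<phi> x \<partial>gauss_borel)"
    using gauss_operator_nonneg[OF Suc.prems(2,3)] Suc.prems
    by (intro Suc.IH unit_lipschitz_gauss_operator gauss_operator_measurable) auto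
  also have "(\<integral>\<^sup>+x. ennreal (gauss_operator h x) \<partial>gauss_borel) = (\<integral>\<^sup>+x. ennreal (h x) \<partial>gauss_borel)"
    using nn_integral_gauss_operator[OF _ _ Suc.prems(2,3), of "\<lambda>_. 1"] by simp
  also have "7 / 8 * s * (7 / 8) ^ k = s * (7 / 8) ^ Suc k" by simp
  finally show ?case .
qed

text \<open>One application of \<open>gauss_map\<close> is spent on expanding over the first digit;
  the other k contract the Lipschitz constant 2 / N of \<open>weight i\<close>, where N = (i + 1) (i
  + 2). The mean of the weight is at least 1 / (2 N), so the additive error is at most 4 (7/8)^k
  times that mean. This relative error is the same for all digits, so the estimates can be summed
  against any g.\<close>

lemma digit_upper_mixing:
  fixes g :: "nat \<Rightarrow> ennreal"
  assumes [measurable]: "\<phi> \<in> borel_measurable borel"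
  shows "(\<integral>\<^sup>+x. g (digit 0 x) * \<phi> ((gauss_map ^^ Suc k) x) \<partial>gauss_borel)
    \<le> ennreal (1 + 4 * (7 / 8) ^ k) * (\<integral>\<^sup>+x. g (digit 0 x) \<partial>gauss_borel) * (\<integral>\<^sup>+x. \<phi> x \<partial>gauss_borel)"
proof -
  have [measurable]: "g \<in> count_space UNIV \<rightarrow>\<^sub>M borel" by simp
  have expand: "(\<integral>\<^sup>+x. g (digit 0 x) * \<psi> (gauss_map x) \<partial>gauss_borel)
      = (\<Sum>i. g (Suc i) * (\<integral>\<^sup>+x. ennreal (weight i x) * \<psi> x \<partial>gauss_borel))"
    if [measurable]: "\<psi> \<in> borel_measurable borel" for \<psi>
  proof -
    have "(\<integral>\<^sup>+x. g (digit 0 x) * \<psi> (gauss_map x) \<partial>gauss_borel)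
      = (\<Sum>i. \<integral>\<^sup>+x. ennreal (weight i x) * g (digit 0 (branch i x)) * \<psi> x \<partial>gauss_borel)"
      by (rule nn_integral_gauss_branches_map) measurable
    also have "\<dots> = (\<Sum>i. \<integral>\<^sup>+x. g (Suc i) * (ennreal (weight i x) * \<psi> x) \<partial>gauss_borel)"
      by (intro suminf_cong nn_integral_cong_AE, rule eventually_mono[OF AE_irr_unit])
        (simp add: digit_0_branch mult_ac)
    also have "\<dots> = (\<Sum>i. g (Suc i) * (\<integral>\<^sup>+x. ennreal (weight i x) * \<psi> x \<partial>gauss_borel))"
      by (intro suminf_cong nn_integral_cmult) measurable
    finally show ?thesis .
  qed
  let ?q = "4 * (7 / 8 :: real) ^ k"
  have w: "(\<integral>\<^sup>+x. ennreal (weight i x) * \<phi> ((gauss_map ^^ k) x) \<partial>gauss_borel)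
     \<le> ennreal (1 + ?q) * (\<integral>\<^sup>+x. ennreal (weight i x) \<partial>gauss_borel) * (\<integral>\<^sup>+x. \<phi> x \<partial>gauss_borel)" for i
  proof -
    let ?N = "(real i + 1) * (real i + 2)"
    have "unit_lipschitz (2 / ?N) (weight i)"
      using weight_lipschitz by (simp add: unit_lipschitz_def)
    from nn_integral_lipschitz_funpow_le[OF weight_measurable assms this, of k]
    have "(\<integral>\<^sup>+x. ennreal (weight i x) * \<phi> ((gauss_map ^^ k) x) \<partial>gauss_borel)
      \<le> ((\<integral>\<^sup>+x. ennreal (weight i x) \<partial>gauss_borel) + ennreal (2 / ?N * (7 / 8) ^ k)) * (\<integral>\<^sup>+x. \<phi> x \<partial>gauss_borel)"
      using weight_nonneg by simp
    also have "\<dots> \<le> ((\<integral>\<^sup>+x. ennreal (weight i x) \<partial>gauss_borel) + ennreal ?q * (\<integral>\<^sup>+x. ennreal (weight i x) \<partial>gauss_borel))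
        * (\<integral>\<^sup>+x. \<phi> x \<partial>gauss_borel)"
    proof (intro mult_right_mono add_left_mono)
      have "ennreal (1 / (2 * ?N)) = (\<integral>\<^sup>+x. ennreal (1 / (2 * ?N)) \<partial>gauss_borel)"
        using gauss.emeasure_space_1 by simp
      also have "\<dots> \<le> (\<integral>\<^sup>+x. ennreal (weight i x) \<partial>gauss_borel)"
        by (intro nn_integral_mono_AE, rule eventually_mono[OF AE_irr_unit])
          (use weight_lower_bound in \<open>auto simp: irr_unit_def intro!: ennreal_leI\<close>)
      finally have "ennreal ?q * ennreal (1 / (2 * ?N)) \<le> ennreal ?q * (\<integral>\<^sup>+x. ennreal (weight i x) \<partial>gauss_borel)"
        by (rule mult_left_mono) simp
      moreover have "ennreal ?q * ennreal (1 / (2 * ?N)) = ennreal (2 / ?N * (7 / 8) ^ k)"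
        by (subst ennreal_mult'[symmetric]) auto
      ultimately show "ennreal (2 / ?N * (7 / 8) ^ k) \<le> ennreal ?q * (\<integral>\<^sup>+x. ennreal (weight i x) \<partial>gauss_borel)"
        by simp
    qed simp
    also have "\<dots> = ennreal (1 + ?q) * (\<integral>\<^sup>+x. ennreal (weight i x) \<partial>gauss_borel) * (\<integral>\<^sup>+x. \<phi> x \<partial>gauss_borel)"
      by (simp add: distrib_right)
    finally show ?thesis .
  qed
  have "(\<integral>\<^sup>+x. g (digit 0 x) * \<phi> ((gauss_map ^^ Suc k) x) \<partial>gauss_borel)
    = (\<integral>\<^sup>+x. g (digit 0 x) * (\<lambda>x. \<phi> ((gauss_map ^^ k) x)) (gauss_map x) \<partial>gauss_borel)"
    by (simp add: funpow_swap1)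
  also have "\<dots> = (\<Sum>i. g (Suc i) * (\<integral>\<^sup>+x. ennreal (weight i x) * \<phi> ((gauss_map ^^ k) x) \<partial>gauss_borel))"
    by (rule expand) measurable
  also have "\<dots> \<le> (\<Sum>i. g (Suc i) * (ennreal (1 + ?q) * (\<integral>\<^sup>+x. ennreal (weight i x) \<partial>gauss_borel) * (\<integral>\<^sup>+x. \<phi> x \<partial>gauss_borel)))"
    by (intro suminf_le mult_left_mono w) auto
  also have "\<dots> = (\<Sum>i. ennreal (1 + ?q) * (g (Suc i) * (\<integral>\<^sup>+x. ennreal (weight i x) \<partial>gauss_borel)) * (\<integral>\<^sup>+x. \<phi> x \<partial>gauss_borel))"
    by (simp add: mult_ac)
  also have "\<dots> = ennreal (1 + ?q) * (\<Sum>i. g (Suc i) * (\<integral>\<^sup>+x. ennreal (weight i x) \<partial>gauss_borel)) * (\<integral>\<^sup>+x. \<phi> x \<partial>gauss_borel)"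
    by simp
  also have "(\<Sum>i. g (Suc i) * (\<integral>\<^sup>+x. ennreal (weight i x) \<partial>gauss_borel)) = (\<integral>\<^sup>+x. g (digit 0 x) \<partial>gauss_borel)"
    using expand[of "\<lambda>_. 1"] by simp
  finally show ?thesis .
qed

section \<open>Variance and truncation\<close>

lemma integrable_gauss_bounded:
  fixes h :: "real \<Rightarrow> real"
  assumes "h \<in> borel_measurable borel" "\<And>x. \<bar>h x\<bar> \<le> K"
  shows "integrable gauss_borel h"
  using assms by (intro gauss.integrable_const_bound[of _ K]) (auto simp: measurable_cong_sets[OF sets_gauss_borel refl])

lemma digit_fun_measurable [measurable]:
  fixes g :: "nat \<Rightarrow> real"
  shows "(\<lambda>x. g (digit k x)) \<in> borel_measurable borel"
  by measurable

lemma integral_digit: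
  fixes g :: "nat \<Rightarrow> real"
  shows "(\<integral>x. g (digit k x) \<partial>gauss_borel) = (\<integral>x. g (digit 0 x) \<partial>gauss_borel)"
  using integral_gauss_map_funpow[of "\<lambda>x. g (digit 0 x)" k] by (simp add: digit_funpow)

lemma integral_digit_mult_le:
  fixes g :: "nat \<Rightarrow> real"
  assumes g: "\<And>m. 0 \<le> g m" "\<And>m. g m \<le> K"
  shows "(\<integral>x. g (digit i x) * g (digit (i + Suc k) x) \<partial>gauss_borel)
    \<le> (1 + 4 * (7 / 8) ^ k) * (\<integral>x. g (digit 0 x) \<partial>gauss_borel)\<^sup>2"
proof -
  let ?v = "\<integral>x. g (digit 0 x) \<partial>gauss_borel"
  have K: "0 \<le> K" using g[of 0] by linarith
  have int0: "integrable gauss_borel (\<lambda>x. g (digit 0 x))"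
    by (rule integrable_gauss_bounded[of _ K]) (use g in auto)
  have int: "integrable gauss_borel (\<lambda>x. g (digit 0 x) * g (digit (Suc k) x))"
    by (rule integrable_gauss_bounded[of _ "K * K"]) (use g K in \<open>auto simp: abs_mult intro!: mult_mono\<close>)
  have v: "0 \<le> ?v" using g by (intro integral_nonneg_AE) auto
  have "(\<integral>x. g (digit i x) * g (digit (i + Suc k) x) \<partial>gauss_borel)
      = (\<integral>x. g (digit 0 x) * g (digit (Suc k) x) \<partial>gauss_borel)"
    using integral_gauss_map_funpow[of "\<lambda>x. g (digit 0 x) * g (digit (Suc k) x)" i]
    by (simp add: digit_funpow add.commute)
  moreover have "ennreal (\<integral>x. g (digit 0 x) * g (digit (Suc k) x) \<partial>gauss_borel)
    \<le> ennreal ((1 + 4 * (7 / 8) ^ k) * ?v\<^sup>2)"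
  proof -
    have v': "(\<integral>\<^sup>+x. ennreal (g (digit 0 x)) \<partial>gauss_borel) = ennreal ?v"
      using g by (intro nn_integral_eq_integral[OF int0]) auto
    have "ennreal (\<integral>x. g (digit 0 x) * g (digit (Suc k) x) \<partial>gauss_borel)
        = (\<integral>\<^sup>+x. ennreal (g (digit 0 x)) * ennreal (g (digit 0 ((gauss_map ^^ Suc k) x))) \<partial>gauss_borel)"
      using g by (subst nn_integral_eq_integral[OF int, symmetric])
        (auto simp: ennreal_mult' digit_funpow simp del: funpow.simps)
    also have "\<dots> \<le> ennreal (1 + 4 * (7 / 8) ^ k) * (\<integral>\<^sup>+x. ennreal (g (digit 0 x)) \<partial>gauss_borel)
        * (\<integral>\<^sup>+x. ennreal (g (digit 0 x)) \<partial>gauss_borel)"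
      by (rule digit_upper_mixing[where g = "\<lambda>m. ennreal (g m)"]) measurable
    also have "\<dots> = ennreal ((1 + 4 * (7 / 8) ^ k) * ?v\<^sup>2)"
      unfolding v' using v by (simp add: ennreal_mult' power2_eq_square mult.assoc)
    finally show ?thesis .
  qed
  moreover have "0 \<le> (1 + 4 * (7 / 8) ^ k) * ?v\<^sup>2" by simp
  ultimately show ?thesis by (simp only: ennreal_le_iff)
qed

lemma sum_reverse_geometric_le:
  fixes q :: real
  assumes "0 \<le> q" "q < 1"
  shows "(\<Sum>i<n. q ^ (n - Suc i)) \<le> 1 / (1 - q)"
proof -
  have "(\<Sum>i<n. q ^ (n - Suc i)) = (\<Sum>i<n. q ^ i)" by (rule sum.nat_diff_reindex)
  also have "\<dots> = (1 - q ^ n) / (1 - q)" using assms by (simp add: sum_gp_strict)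
  also have "\<dots> \<le> 1 / (1 - q)" using assms by (intro divide_right_mono) auto
  finally show ?thesis .
qed

text \<open>The mixing bound is one-sided and concerns nonnegative functions, hence
  \<open>0 \<le> g\<close>. A new summand adds its own variance and twice its covariances with the
  earlier ones. These total at most 4 * 8 times v^2, where 8 is the sum of the geometric series with
  ratio 7/8; so 65 = 1 + 2 * 32.\<close>

lemma variance_digit_sum_nonneg:
  fixes g :: "nat \<Rightarrow> real"
  assumes g: "\<And>m. 0 \<le> g m" "\<And>m. g m \<le> K"
  defines "v \<equiv> \<integral>x. g (digit 0 x) \<partial>gauss_borel"
  shows "(\<integral>x. (\<Sum>k<n. g (digit k x) - v)\<^sup>2 \<partial>gauss_borel)
    \<le> 65 * real n * (\<integral>x. (g (digit 0 x))\<^sup>2 \<partial>gauss_borel)"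
proof (induction n)
  case (Suc n)
  let ?Z = "\<lambda>k x. g (digit k x) - v" and ?w = "\<integral>x. (g (digit 0 x))\<^sup>2 \<partial>gauss_borel"
  have K: "0 \<le> K" using g[of 0] by linarith
  have v0: "0 \<le> v" unfolding v_def using g by (intro integral_nonneg_AE) auto
  have intX: "integrable gauss_borel (\<lambda>x. g (digit k x))" for k
    by (rule integrable_gauss_bounded[of _ K]) (use g in auto)
  have intXX: "integrable gauss_borel (\<lambda>x. g (digit j x) * g (digit k x))" for j k
    by (rule integrable_gauss_bounded[of _ "K * K"]) (use g K in \<open>auto simp: abs_mult intro!: mult_mono\<close>)
  have EX: "(\<integral>x. g (digit k x) \<partial>gauss_borel) = v" for k
    unfolding v_def by (rule integral_digit)
  have ZZ: "?Z j x * ?Z k x = g (digit j x) * g (digit k x) - v * g (digit j x) - v * g (digit k x) + v * v" for j k x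
    by (simp add: algebra_simps)
  have intZZ: "integrable gauss_borel (\<lambda>x. ?Z j x * ?Z k x)" for j k
    unfolding ZZ using intX intXX by auto
  have EZZ: "(\<integral>x. ?Z j x * ?Z k x \<partial>gauss_borel) = (\<integral>x. g (digit j x) * g (digit k x) \<partial>gauss_borel) - v\<^sup>2" for j k
    unfolding ZZ using intX intXX gauss.prob_space by (simp add: EX power2_eq_square)
  have vw: "v\<^sup>2 \<le> ?w"
  proof -
    have "0 \<le> (\<integral>x. ?Z 0 x * ?Z 0 x \<partial>gauss_borel)" by (intro integral_nonneg_AE) auto
    then show ?thesis unfolding EZZ by (simp add: power2_eq_square)
  qed
  have diag: "(\<integral>x. ?Z n x * ?Z n x \<partial>gauss_borel) \<le> ?w"
    unfolding EZZ using integral_digit[of "\<lambda>m. g m * g m" n] by (simp add: power2_eq_square)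
  have off: "(\<integral>x. ?Z i x * ?Z n x \<partial>gauss_borel) \<le> 4 * (7 / 8) ^ (n - Suc i) * v\<^sup>2" if "i < n" for i
  proof -
    have "i + Suc (n - Suc i) = n" using that by simp
    then show ?thesis
      using integral_digit_mult_le[of g K i "n - Suc i", OF g] unfolding EZZ v_def[symmetric]
      by (simp add: algebra_simps)
  qed
  have "(\<Sum>i<n. \<integral>x. ?Z i x * ?Z n x \<partial>gauss_borel) \<le> (\<Sum>i<n. 4 * (7 / 8) ^ (n - Suc i) * v\<^sup>2)"
    by (intro sum_mono off) auto
  also have "\<dots> = 4 * (\<Sum>i<n. (7 / 8) ^ (n - Suc i)) * v\<^sup>2"
    by (simp only: sum_distrib_left sum_distrib_right mult.assoc)
  also have "\<dots> \<le> 4 * 8 * v\<^sup>2"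
    using sum_reverse_geometric_le[of "7 / 8" n] by (intro mult_right_mono mult_left_mono) auto
  finally have cross: "(\<Sum>i<n. \<integral>x. ?Z i x * ?Z n x \<partial>gauss_borel) \<le> 32 * ?w" using vw by linarith
  have sq: "(\<Sum>k<m. ?Z k x)\<^sup>2 = (\<Sum>j<m. \<Sum>k<m. ?Z j x * ?Z k x)" for m x
    by (simp add: power2_eq_square sum_product)
  have intS: "integrable gauss_borel (\<lambda>x. (\<Sum>k<m. ?Z k x)\<^sup>2)" for m
    unfolding sq by (intro Bochner_Integration.integrable_sum intZZ)
  have "(\<Sum>k<Suc n. ?Z k x)\<^sup>2 = (\<Sum>k<n. ?Z k x)\<^sup>2 + 2 * (\<Sum>i<n. ?Z i x * ?Z n x) + ?Z n x * ?Z n x" for x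
  proof -
    have "(a + b)\<^sup>2 = a\<^sup>2 + 2 * (a * b) + b * b" for a b :: real
      by (simp add: power2_eq_square algebra_simps)
    then show ?thesis by (simp only: sum.lessThan_Suc sum_distrib_right)
  qed
  then have "(\<integral>x. (\<Sum>k<Suc n. ?Z k x)\<^sup>2 \<partial>gauss_borel)
    = (\<integral>x. (\<Sum>k<n. ?Z k x)\<^sup>2 + 2 * (\<Sum>i<n. ?Z i x * ?Z n x) + ?Z n x * ?Z n x \<partial>gauss_borel)"
    by presburger
  also have "\<dots> = (\<integral>x. (\<Sum>k<n. ?Z k x)\<^sup>2 \<partial>gauss_borel) + 2 * (\<Sum>i<n. \<integral>x. ?Z i x * ?Z n x \<partial>gauss_borel)
      + (\<integral>x. ?Z n x * ?Z n x \<partial>gauss_borel)"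
    using intS intZZ by (simp add: Bochner_Integration.integral_add Bochner_Integration.integral_sum
        Bochner_Integration.integrable_sum Bochner_Integration.integrable_add
        del: integral_diff Bochner_Integration.integral_diff)
  also have "\<dots> \<le> 65 * real (Suc n) * ?w"
    using Suc.IH diag cross by (simp add: algebra_simps)
  finally show ?case .
qed simp

text \<open>For signed g, an upper bound on mixed products does not control the covariances
  directly, so the positive and negative parts are treated separately. Recombining them by (P - Q)^2
  <= 2 P^2 + 2 Q^2 doubles the constant 65.\<close>

lemma variance_digit_sum:
  fixes g :: "nat \<Rightarrow> real"
  assumes g: "\<And>m. \<bar>g m\<bar> \<le> K"
  shows "(\<integral>x. (\<Sum>k<n. g (digit k x) - (\<integral>x. g (digit 0 x) \<partial>gauss_borel))\<^sup>2 \<partial>gauss_borel)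
    \<le> 130 * real n * (\<integral>x. (g (digit 0 x))\<^sup>2 \<partial>gauss_borel)"
proof -
  define p where "p = (\<lambda>m. max 0 (g m))"
  define q where "q = (\<lambda>m. max 0 (- g m))"
  have gpq: "g m = p m - q m" and sq: "(g m)\<^sup>2 = (p m)\<^sup>2 + (q m)\<^sup>2" for m
    by (auto simp: p_def q_def max_def)
  have K: "0 \<le> K" using g[of 0] by linarith
  have p: "0 \<le> p m" "p m \<le> K" and q: "0 \<le> q m" "q m \<le> K" for m
    using g[of m] K by (auto simp: p_def q_def)
  have int: "integrable gauss_borel (\<lambda>x. r (digit k x))" "integrable gauss_borel (\<lambda>x. (r (digit k x))\<^sup>2)"
    "integrable gauss_borel (\<lambda>x. (\<Sum>k<n. r (digit k x) - c)\<^sup>2)"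
    if r: "\<And>m. 0 \<le> r m" "\<And>m. r m \<le> K" for r :: "nat \<Rightarrow> real" and k c
  proof -
    show "integrable gauss_borel (\<lambda>x. r (digit k x))"
      by (rule integrable_gauss_bounded[of _ K]) (use r in auto)
    show "integrable gauss_borel (\<lambda>x. (r (digit k x))\<^sup>2)"
      by (rule integrable_gauss_bounded[of _ "K\<^sup>2"]) (use r in \<open>auto intro!: power_mono\<close>)
    show "integrable gauss_borel (\<lambda>x. (\<Sum>k<n. r (digit k x) - c)\<^sup>2)"
    proof (rule integrable_gauss_bounded[of _ "(real n * (K + \<bar>c\<bar>))\<^sup>2"])
      fix x
      have "\<bar>\<Sum>k<n. r (digit k x) - c\<bar> \<le> (\<Sum>k<n. K + \<bar>c\<bar>)"
        by (rule order_trans[OF sum_abs], rule sum_mono) (use r in \<open>auto intro!: order_trans[OF abs_triangle_ineq4] add_mono\<close>)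
      then show "\<bar>(\<Sum>k<n. r (digit k x) - c)\<^sup>2\<bar> \<le> (real n * (K + \<bar>c\<bar>))\<^sup>2"
        by (simp add: abs_le_square_iff[symmetric])
    qed measurable
  qed
  define P where "P = (\<lambda>x. \<Sum>k<n. p (digit k x) - (\<integral>x. p (digit 0 x) \<partial>gauss_borel))"
  define Q where "Q = (\<lambda>x. \<Sum>k<n. q (digit k x) - (\<integral>x. q (digit 0 x) \<partial>gauss_borel))"
  have "(\<Sum>k<n. g (digit k x) - (\<integral>x. g (digit 0 x) \<partial>gauss_borel)) = P x - Q x" for x
  proof -
    have E: "(\<integral>x. p (digit 0 x) - q (digit 0 x) \<partial>gauss_borel)
        = (\<integral>x. p (digit 0 x) \<partial>gauss_borel) - (\<integral>x. q (digit 0 x) \<partial>gauss_borel)"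
      using int(1)[of p, OF p] int(1)[of q, OF q] by simp
    show ?thesis unfolding P_def Q_def gpq E
      by (subst sum_subtractf[symmetric]) (intro sum.cong refl, simp)
  qed
  moreover have "(P x - Q x)\<^sup>2 \<le> 2 * (P x)\<^sup>2 + 2 * (Q x)\<^sup>2" for x
    using zero_le_power2[of "P x + Q x"] by (simp add: power2_eq_square algebra_simps)
  ultimately have "(\<integral>x. (\<Sum>k<n. g (digit k x) - (\<integral>x. g (digit 0 x) \<partial>gauss_borel))\<^sup>2 \<partial>gauss_borel)
      \<le> (\<integral>x. 2 * (P x)\<^sup>2 + 2 * (Q x)\<^sup>2 \<partial>gauss_borel)"
    using int(3)[of p, OF p] int(3)[of q, OF q] unfolding P_def Q_def
    by (intro integral_mono') auto
  also have "\<dots> = 2 * (\<integral>x. (P x)\<^sup>2 \<partial>gauss_borel) + 2 * (\<integral>x. (Q x)\<^sup>2 \<partial>gauss_borel)"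
    using int(3)[of p, OF p] int(3)[of q, OF q] unfolding P_def Q_def by simp
  also have "\<dots> \<le> 2 * (65 * real n * (\<integral>x. (p (digit 0 x))\<^sup>2 \<partial>gauss_borel))
      + 2 * (65 * real n * (\<integral>x. (q (digit 0 x))\<^sup>2 \<partial>gauss_borel))"
    unfolding P_def Q_def using variance_digit_sum_nonneg[of p, OF p] variance_digit_sum_nonneg[of q, OF q]
    by (intro add_mono mult_left_mono) auto
  also have "\<dots> = 130 * real n * (\<integral>x. (g (digit 0 x))\<^sup>2 \<partial>gauss_borel)"
    unfolding sq using int(2)[of p, OF p] int(2)[of q, OF q] by (simp add: algebra_simps)
  finally show ?thesis .
qed

text \<open>With s = c^2, the hypothesis says n (s (n + 1) - s n) >= (1 + \<delta>) s n from some
  index on. The numerator n (s (n + 1) - s n) - s n of d (n + 1) - d n is then at least \<delta> s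
  n, which forces d to infinity, and at least a fixed fraction of n (s (n + 1) - s n), which makes
  the increments of d comparable with those of s divided by n.\<close>

lemma normalizing_sequence_growth:
  fixes c :: "nat \<Rightarrow> real"
  assumes c: "\<And>n. n \<ge> 1 \<Longrightarrow> c n > 0"
    and lim: "liminf (\<lambda>n. ereal (real n / (c n)\<^sup>2 * ((c (Suc n))\<^sup>2 - (c n)\<^sup>2))) > 1"
  obtains C N where "0 < C" "1 \<le> N" "\<And>m n. N \<le> m \<Longrightarrow> m \<le> n \<Longrightarrow> c m \<le> c n"
    "\<And>n. N \<le> n \<Longrightarrow> ((c (Suc n))\<^sup>2 - (c n)\<^sup>2) / real n \<le> C * ((c (Suc n))\<^sup>2 / real (Suc n) - (c n)\<^sup>2 / real n)"
    "filterlim (\<lambda>n. (c n)\<^sup>2 / real n) at_top sequentially"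
proof -
  obtain r where r: "1 < ereal r" "ereal r < liminf (\<lambda>n. ereal (real n / (c n)\<^sup>2 * ((c (Suc n))\<^sup>2 - (c n)\<^sup>2)))"
    using ereal_dense2[OF lim] by auto
  define \<delta> where "\<delta> = r - 1"
  have \<delta>: "0 < \<delta>" using r(1) by (simp add: \<delta>_def one_ereal_def)
  from less_LiminfD[OF r(2)] obtain N0 where
    N0: "\<And>n. N0 \<le> n \<Longrightarrow> r < real n / (c n)\<^sup>2 * ((c (Suc n))\<^sup>2 - (c n)\<^sup>2)"
    by (auto simp: eventually_sequentially)
  define N where "N = max 1 N0"
  define s where "s = (\<lambda>n. (c n)\<^sup>2)"
  define d where "d = (\<lambda>n. s n / real n)"
  have s: "0 < s n" if "N \<le> n" for n using c[of n] that by (simp add: s_def N_def)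
  have n0: "0 < real n" if "N \<le> n" for n using that by (simp add: N_def)
  have inc: "(1 + \<delta>) * s n \<le> real n * (s (Suc n) - s n)" if "N \<le> n" for n
  proof -
    have "r < real n / s n * (s (Suc n) - s n)" using N0[of n] that by (simp add: s_def N_def)
    then show ?thesis using s[OF that] by (simp add: \<delta>_def field_simps)
  qed
  have ds: "d (Suc n) - d n = (real n * (s (Suc n) - s n) - s n) / (real n * real (Suc n))" if "N \<le> n" for n
    using n0[OF that] by (simp add: d_def divide_simps) (simp add: algebra_simps)
  have mono1: "c n \<le> c (Suc n)" if "N \<le> n" for n
  proof -
    have "0 < real n * (s (Suc n) - s n)" using inc[OF that] s[OF that] \<delta> mult_pos_pos[of "1 + \<delta>" "s n"] by linarith
    then have "s n \<le> s (Suc n)" using n0[OF that] by (simp add: zero_less_mult_iff)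
    moreover have "0 < c (Suc n)" using c by simp
    ultimately show ?thesis unfolding s_def using power2_le_imp_le[of "c n" "c (Suc n)"] by simp
  qed
  have mono: "c m \<le> c n" if "N \<le> m" "m \<le> n" for m n
    using that(2)
  proof (induction n rule: dec_induct)
    case (step n)
    then show ?case using mono1[of n] that(1) by linarith
  qed simp
  have main: "(s (Suc n) - s n) / real n \<le> 2 * (1 + \<delta>) / \<delta> * (d (Suc n) - d n)" if "N \<le> n" for n
  proof -
    define u where "u = real n * (s (Suc n) - s n)"
    have u: "(1 + \<delta>) * s n \<le> u" "0 < u"
      using inc[OF that] s[OF that] \<delta> mult_pos_pos[of "1 + \<delta>" "s n"] unfolding u_def by linarith+
    \<comment> \<open>The part u - s n retains the fraction \<delta> / (1 + \<delta>) of u. The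
      remaining factor 2 of the constant comes from 1 / n <= 2 / (n + 1).\<close>
    have "\<delta> * u \<le> (1 + \<delta>) * (u - s n)" using u(1) by (simp add: algebra_simps)
    then have 1: "u \<le> (1 + \<delta>) / \<delta> * (u - s n)" using \<delta> by (simp add: field_simps)
    have "(s (Suc n) - s n) / real n = u / (real n * real n)" using n0[OF that] by (simp add: u_def)
    also have "\<dots> \<le> 2 * (u / (real n * real (Suc n)))"
    proof -
      have "1 / real n \<le> 2 / real (Suc n)" using that by (simp add: N_def divide_simps)
      from mult_left_mono[OF this, of "u / real n"] show ?thesis
        using u(2) n0[OF that] by (simp add: mult.commute)
    qed
    also have "\<dots> \<le> 2 * (((1 + \<delta>) / \<delta> * (u - s n)) / (real n * real (Suc n)))"
      using 1 n0[OF that] by (intro mult_left_mono divide_right_mono) auto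
    also have "\<dots> = 2 * (1 + \<delta>) / \<delta> * (d (Suc n) - d n)"
      unfolding ds[OF that] u_def[symmetric] by simp
    finally show ?thesis .
  qed
  have dinc: "\<delta> * d n / real (Suc n) \<le> d (Suc n) - d n" if "N \<le> n" for n
  proof -
    have "\<delta> * d n / real (Suc n) = (\<delta> * s n) / (real n * real (Suc n))" by (simp add: d_def)
    also have "\<dots> \<le> (real n * (s (Suc n) - s n) - s n) / (real n * real (Suc n))"
      using inc[OF that] n0[OF that] by (intro divide_right_mono) (auto simp: algebra_simps)
    finally show ?thesis using ds[OF that] by simp
  qed
  have dpos: "0 < d n" if "N \<le> n" for n using s[OF that] n0[OF that] by (simp add: d_def)
  \<comment> \<open>The increments of d are estimated through \<open>d N\<close>, so the induction
    carries \<open>d N \<le> d n\<close> along; divergence of the harmonic series then gives d its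
    limit.\<close>
  have lower: "d N + \<delta> * d N * (harm n - harm N) \<le> d n \<and> d N \<le> d n" if "N \<le> n" for n
    using that
  proof (induction n rule: dec_induct)
    case (step n)
    have "\<delta> * d N / real (Suc n) \<le> \<delta> * d n / real (Suc n)"
      using step \<delta> by (intro divide_right_mono mult_left_mono) auto
    also have "\<dots> \<le> d (Suc n) - d n" by (rule dinc) fact
    finally have i: "\<delta> * d N / real (Suc n) \<le> d (Suc n) - d n" .
    moreover have "0 \<le> \<delta> * d N / real (Suc n)" using \<delta> dpos[of N] by (intro divide_nonneg_nonneg) auto
    moreover have "\<delta> * d N * (harm (Suc n) - harm N) = \<delta> * d N * (harm n - harm N) + \<delta> * d N / real (Suc n)"
      by (simp add: harm_Suc algebra_simps divide_inverse)
    ultimately show ?case using step by linarith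
  qed simp
  have "filterlim (\<lambda>n. (d N - \<delta> * d N * harm N) + (\<delta> * d N) * harm n) at_top sequentially"
    using \<delta> dpos[of N]
    by (intro filterlim_tendsto_add_at_top[OF tendsto_const] filterlim_tendsto_pos_mult_at_top[OF tendsto_const _ harm_at_top]) auto
  then have "filterlim d at_top sequentially"
  proof (rule filterlim_at_top_mono)
    show "\<forall>\<^sub>F n in sequentially. (d N - \<delta> * d N * harm N) + (\<delta> * d N) * harm n \<le> d n"
      by (rule eventually_mono[OF eventually_ge_at_top[of N]]) (use lower in \<open>simp add: algebra_simps\<close>)
  qed
  then show thesis
    using main mono \<delta> that[of "2 * (1 + \<delta>) / \<delta>" N] unfolding d_def s_def by (auto simp: N_def)
qed

text \<open>An argument of Stolz-Cesaro type, comparing increments of \<open>W\<close> with those of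
  \<open>d\<close>. The minimum in \<open>W\<close> is preferred to the truncated square because
  from n to n + 1 it grows by at most (c (n + 1))^2 - (c n)^2, whereas the truncated square may jump
  from 0 to X^2.\<close>

lemma truncated_second_moment_tendsto:
  fixes c :: "nat \<Rightarrow> real"
  assumes "prob_space M" and [measurable]: "X \<in> borel_measurable M"
    and c: "\<And>n. n \<ge> 1 \<Longrightarrow> c n > 0"
    and lim: "liminf (\<lambda>n. ereal (real n / (c n)\<^sup>2 * ((c (Suc n))\<^sup>2 - (c n)\<^sup>2))) > 1"
    and tail: "(\<lambda>n. real n * measure M {x \<in> space M. \<bar>X x\<bar> > c n}) \<longlonglongrightarrow> 0"
  shows "(\<lambda>n. real n / (c n)\<^sup>2 * (\<integral>x. (X x * indicator {x. \<bar>X x\<bar> \<le> c n} x)\<^sup>2 \<partial>M)) \<longlonglongrightarrow> 0"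
proof -
  interpret prob_space M by fact
  obtain C N where C: "0 < C" and N: "1 \<le> N" and mono: "\<And>m n. N \<le> m \<Longrightarrow> m \<le> n \<Longrightarrow> c m \<le> c n"
    and inc: "\<And>n. N \<le> n \<Longrightarrow> ((c (Suc n))\<^sup>2 - (c n)\<^sup>2) / real n \<le> C * ((c (Suc n))\<^sup>2 / real (Suc n) - (c n)\<^sup>2 / real n)"
    and top: "filterlim (\<lambda>n. (c n)\<^sup>2 / real n) at_top sequentially"
    using normalizing_sequence_growth[OF c lim] by blast
  define d where "d = (\<lambda>n. (c n)\<^sup>2 / real n)"
  define T where "T = (\<lambda>n. measure M {x \<in> space M. \<bar>X x\<bar> > c n})"
  define W where "W = (\<lambda>n. \<integral>x. min ((X x)\<^sup>2) ((c n)\<^sup>2) \<partial>M)"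
  define V where "V = (\<lambda>n. \<integral>x. (X x * indicator {x. \<bar>X x\<bar> \<le> c n} x)\<^sup>2 \<partial>M)"
  have intW: "integrable M (\<lambda>x. min ((X x)\<^sup>2) ((c n)\<^sup>2))" for n
    by (rule integrable_const_bound[of _ "(c n)\<^sup>2"]) auto
  have V0: "0 \<le> V n" for n unfolding V_def by (intro integral_nonneg_AE) auto
  have VW: "V n \<le> W n" if "1 \<le> n" for n
    unfolding V_def W_def
  proof (rule integral_mono'[OF intW])
    fix x
    show "(X x * indicator {x. \<bar>X x\<bar> \<le> c n} x)\<^sup>2 \<le> min ((X x)\<^sup>2) ((c n)\<^sup>2)"
      using c[OF that] by (auto simp: indicator_def abs_le_square_iff[symmetric])
  qed auto
  have step: "W (Suc n) - W n \<le> ((c (Suc n))\<^sup>2 - (c n)\<^sup>2) * T n" if "N \<le> n" for n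
  proof -
    have cc: "0 < c n" "c n \<le> c (Suc n)" using that N c[of n] mono[of n "Suc n"] by auto
    have int: "integrable M (\<lambda>x. ((c (Suc n))\<^sup>2 - (c n)\<^sup>2) * indicator {x \<in> space M. \<bar>X x\<bar> > c n} x)"
      by (intro integrable_mult_right integrable_real_indicator) (auto simp: emeasure_eq_measure)
    have "W (Suc n) - W n = (\<integral>x. min ((X x)\<^sup>2) ((c (Suc n))\<^sup>2) - min ((X x)\<^sup>2) ((c n)\<^sup>2) \<partial>M)"
      unfolding W_def using intW by simp
    also have "\<dots> \<le> (\<integral>x. ((c (Suc n))\<^sup>2 - (c n)\<^sup>2) * indicator {x \<in> space M. \<bar>X x\<bar> > c n} x \<partial>M)"
    proof (rule integral_mono[OF _ int])
      show "integrable M (\<lambda>x. min ((X x)\<^sup>2) ((c (Suc n))\<^sup>2) - min ((X x)\<^sup>2) ((c n)\<^sup>2))"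
        using intW by simp
      fix x assume "x \<in> space M"
      have "(c n)\<^sup>2 \<le> (c (Suc n))\<^sup>2" using cc by (intro power_mono) auto
      moreover have "(X x)\<^sup>2 \<le> (c n)\<^sup>2" if "\<not> c n < \<bar>X x\<bar>"
        using that cc by (simp add: abs_le_square_iff[symmetric])
      moreover have "(c n)\<^sup>2 \<le> (X x)\<^sup>2" if "c n < \<bar>X x\<bar>"
        using that cc by (simp add: abs_le_square_iff[symmetric])
      ultimately show "min ((X x)\<^sup>2) ((c (Suc n))\<^sup>2) - min ((X x)\<^sup>2) ((c n)\<^sup>2)
          \<le> ((c (Suc n))\<^sup>2 - (c n)\<^sup>2) * indicator {x \<in> space M. \<bar>X x\<bar> > c n} x"
        using \<open>x \<in> space M\<close> by (auto simp: indicator_def min_def)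
    qed
    also have "\<dots> = ((c (Suc n))\<^sup>2 - (c n)\<^sup>2) * T n" by (simp add: T_def)
    finally show ?thesis .
  qed
  have T0: "0 \<le> T n" for n by (simp add: T_def)
  have "(\<lambda>n. V n / d n) \<longlonglongrightarrow> 0"
  proof (rule order_tendstoI)
    fix a :: real assume "a < 0"
    have "\<forall>\<^sub>F n in sequentially. 1 \<le> n" by (rule eventually_ge_at_top)
    then show "\<forall>\<^sub>F n in sequentially. a < V n / d n"
    proof eventually_elim
      case (elim n)
      have "0 \<le> V n / d n" using V0 by (simp add: d_def)
      with \<open>a < 0\<close> show ?case by linarith
    qed
  next
    fix a :: real assume a: "0 < a"
    \<comment> \<open>Half of a bounds the increments of \<open>W\<close> relative to those of
      \<open>d\<close>; the other half absorbs the starting value \<open>W K\<close>.\<close>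
    define \<epsilon> where "\<epsilon> = a / (2 * C)"
    have \<epsilon>: "0 < \<epsilon>" "\<epsilon> * C = a / 2" using a C by (auto simp: \<epsilon>_def)
    have "\<forall>\<^sub>F n in sequentially. real n * T n < \<epsilon>"
      using order_tendstoD(2)[OF tail \<epsilon>(1)] by (simp add: T_def)
    then obtain K0 where K0: "\<And>n. K0 \<le> n \<Longrightarrow> real n * T n < \<epsilon>" by (auto simp: eventually_sequentially)
    define K where "K = max N K0"
    have inc1: "W (Suc n) - W n \<le> a / 2 * (d (Suc n) - d n)" if "K \<le> n" for n
    proof -
      have n: "N \<le> n" "K0 \<le> n" "0 < real n" using that N by (auto simp: K_def)
      have "0 \<le> (c (Suc n))\<^sup>2 - (c n)\<^sup>2"
        using mono[of n "Suc n"] n N c[of n] by (simp add: power_mono)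
      then have "((c (Suc n))\<^sup>2 - (c n)\<^sup>2) / real n * (real n * T n) \<le> ((c (Suc n))\<^sup>2 - (c n)\<^sup>2) / real n * \<epsilon>"
        using K0[OF n(2)] n by (intro mult_left_mono divide_nonneg_nonneg) auto
      also have "\<dots> \<le> C * (d (Suc n) - d n) * \<epsilon>"
        using inc[OF n(1)] \<epsilon>(1) unfolding d_def by (intro mult_right_mono) auto
      also have "\<dots> = a / 2 * (d (Suc n) - d n)" unfolding \<epsilon>(2)[symmetric] by simp
      finally show ?thesis using step[OF n(1)] n by simp
    qed
    have W: "W n - W K \<le> a / 2 * (d n - d K)" if "K \<le> n" for n
      using that
    proof (induction n rule: dec_induct)
      case (step n)
      then show ?case using inc1[of n] by (simp add: algebra_simps)
    qed simp
    have dK: "0 \<le> d K" by (simp add: d_def)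
    have "\<forall>\<^sub>F n in sequentially. 2 * \<bar>W K\<bar> / a < d n"
      using top unfolding d_def filterlim_at_top_dense by blast
    moreover have "\<forall>\<^sub>F n in sequentially. max 1 K \<le> n" by (rule eventually_ge_at_top)
    ultimately show "\<forall>\<^sub>F n in sequentially. V n / d n < a"
    proof eventually_elim
      case (elim n)
      have dn: "0 < d n" using c[of n] elim by (simp add: d_def)
      have "a / 2 * (d n - d K) \<le> a / 2 * d n" using a dK by (intro mult_left_mono) auto
      moreover have "V n \<le> W n" "W n - W K \<le> a / 2 * (d n - d K)" using VW[of n] W[of n] elim by auto
      ultimately have "V n \<le> W K + a / 2 * d n" by linarith
      moreover have "\<bar>W K\<bar> < a / 2 * d n" using elim(1) a by (simp add: field_simps)
      ultimately have "V n < a * d n" by linarith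
      then show ?case using dn by (simp add: field_simps)
    qed
  qed
  then show ?thesis by (simp add: V_def d_def mult.commute)
qed

lemma truncated_sum_deviation:
  fixes F :: "nat \<Rightarrow> real" and c :: real
  assumes "0 < t"
  defines "g \<equiv> \<lambda>m. F m * indicator {m. \<bar>F m\<bar> \<le> c} m"
  shows "measure gauss_borel {x. \<bar>\<Sum>k<n. F (digit k x) - (\<integral>x. g (digit 0 x) \<partial>gauss_borel)\<bar> > t}
    \<le> real n * measure gauss_borel {x. \<bar>F (digit 0 x)\<bar> > c}
      + 130 * real n / t\<^sup>2 * (\<integral>x. (g (digit 0 x))\<^sup>2 \<partial>gauss_borel)"
proof -
  let ?v = "\<integral>x. g (digit 0 x) \<partial>gauss_borel"
  let ?S = "\<lambda>x. \<Sum>k<n. g (digit k x) - ?v"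
  let ?E = "\<lambda>k. {x. \<bar>F (digit k x)\<bar> > c}"
  let ?D = "{x. t\<^sup>2 \<le> (?S x)\<^sup>2}"
  have gb: "\<bar>g m\<bar> \<le> \<bar>c\<bar>" for m by (auto simp: g_def indicator_def)
  have E: "?E k \<in> sets borel" for k by measurable
  have D: "?D \<in> sets borel" by measurable
  have Ek: "measure gauss_borel (?E k) = measure gauss_borel (?E 0)" for k
    using measure_gauss_map_funpow[OF E[of 0], of k] by (simp add: vimage_def digit_funpow)
  have int: "integrable gauss_borel (\<lambda>x. (?S x)\<^sup>2)"
  proof (rule integrable_gauss_bounded[of _ "(real n * (\<bar>c\<bar> + \<bar>?v\<bar>))\<^sup>2"])
    fix x
    have "\<bar>?S x\<bar> \<le> (\<Sum>k<n. \<bar>c\<bar> + \<bar>?v\<bar>)"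
      by (rule order_trans[OF sum_abs], rule sum_mono) (auto intro!: order_trans[OF abs_triangle_ineq4] add_mono gb)
    then show "\<bar>(?S x)\<^sup>2\<bar> \<le> (real n * (\<bar>c\<bar> + \<bar>?v\<bar>))\<^sup>2"
      by (simp add: abs_le_square_iff[symmetric])
  qed measurable
  have "{x. \<bar>\<Sum>k<n. F (digit k x) - ?v\<bar> > t} \<subseteq> (\<Union>k<n. ?E k) \<union> ?D"
  proof
    fix x assume x: "x \<in> {x. \<bar>\<Sum>k<n. F (digit k x) - ?v\<bar> > t}"
    show "x \<in> (\<Union>k<n. ?E k) \<union> ?D"
    proof (cases "x \<in> (\<Union>k<n. ?E k)")
      case False
      then have "g (digit k x) = F (digit k x)" if "k < n" for k
        using that by (auto simp: g_def indicator_def not_less)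
      then have "?S x = (\<Sum>k<n. F (digit k x) - ?v)" by (intro sum.cong) auto
      then have "t < \<bar>?S x\<bar>" using x by simp
      then show ?thesis using assms(1) by (simp add: abs_le_square_iff[symmetric])
    qed simp
  qed
  moreover have U: "(\<Union>k<n. ?E k) \<in> sets gauss_borel" "?D \<in> sets gauss_borel"
    unfolding sets_gauss_borel using E D by blast+
  ultimately have "measure gauss_borel {x. \<bar>\<Sum>k<n. F (digit k x) - ?v\<bar> > t} \<le> measure gauss_borel ((\<Union>k<n. ?E k) \<union> ?D)"
    by (intro gauss.finite_measure_mono sets.Un)
  also have "\<dots> \<le> measure gauss_borel (\<Union>k<n. ?E k) + measure gauss_borel ?D"
    by (rule measure_Un_le[OF U])
  also have "measure gauss_borel (\<Union>k<n. ?E k) \<le> (\<Sum>k<n. measure gauss_borel (?E k))"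
    by (rule measure_UNION_le[OF finite_lessThan]) (simp only: sets_gauss_borel E)
  also have "\<dots> = real n * measure gauss_borel (?E 0)"
  proof -
    have "(\<Sum>k<n. measure gauss_borel (?E k)) = (\<Sum>k<n. measure gauss_borel (?E 0))"
      by (intro sum.cong refl Ek)
    then show ?thesis by simp
  qed
  also have "measure gauss_borel ?D \<le> (\<integral>x. (?S x)\<^sup>2 \<partial>gauss_borel) / t\<^sup>2"
    using integral_Markov_inequality_measure[OF int, of "{}" "t\<^sup>2"] assms(1) by simp
  also have "\<dots> \<le> (130 * real n * (\<integral>x. (g (digit 0 x))\<^sup>2 \<partial>gauss_borel)) / t\<^sup>2"
    using variance_digit_sum[of g, OF gb] by (intro divide_right_mono) auto
  finally show ?thesis by simp
qed

section \<open>Necessity of the tail condition\<close>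

definition digit_sum :: "(nat \<Rightarrow> real) \<Rightarrow> nat \<Rightarrow> real \<Rightarrow> real" where
  "digit_sum F n x = (\<Sum>k<n. F (digit k x))"

lemma digit_sum_measurable [measurable]: "digit_sum F n \<in> borel_measurable borel"
  unfolding digit_sum_def[abs_def] by measurable

lemma digit_sum_add: "digit_sum F (j + k) x = digit_sum F j x + digit_sum F k ((gauss_map ^^ j) x)"
  by (induction k) (simp_all add: digit_sum_def digit_funpow add.commute)

text \<open>Q may inspect the whole path of partial sums; replacing the sums beyond k by 0 hides
  those that read later digits.\<close>

lemma digits_determine_digit_sums:
  "digits_determine k {x. Q (\<lambda>j. if j \<le> k then digit_sum F j x else 0)}"
  unfolding digits_determine_def
proof (intro ballI impI)
  fix x y
  assume eq: "\<forall>j<k. digit j x = digit j y" and x: "x \<in> {x. Q (\<lambda>j. if j \<le> k then digit_sum F j x else 0)}"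
  have "(\<lambda>j. if j \<le> k then digit_sum F j x else 0) = (\<lambda>j. if j \<le> k then digit_sum F j y else 0)"
    using eq by (intro ext) (simp add: digit_sum_def)
  with x show "y \<in> {x. Q (\<lambda>j. if j \<le> k then digit_sum F j x else 0)}"
    unfolding mem_Collect_eq by (simp only:)
qed

section \<open>Centering constants and Ottaviani's inequality\<close>

lemma gauss_tail_tendsto_0:
  fixes Z :: "real \<Rightarrow> real"
  assumes [measurable]: "Z \<in> borel_measurable borel" and e: "filterlim e at_top sequentially"
  shows "(\<lambda>n. measure gauss_borel {x. \<bar>Z x\<bar> > e n}) \<longlonglongrightarrow> 0"
proof (rule order_tendstoI)
  fix a :: real assume "a < 0"
  then show "\<forall>\<^sub>F n in sequentially. a < measure gauss_borel {x. \<bar>Z x\<bar> > e n}"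
    using measure_nonneg less_le_trans by (intro always_eventually allI) blast
next
  fix a :: real assume a: "0 < a"
  let ?A = "\<lambda>m. {x. \<bar>Z x\<bar> > real m}"
  have A: "?A m \<in> sets gauss_borel" for m unfolding sets_gauss_borel by measurable
  have "decseq ?A" by (rule decseq_SucI) auto
  moreover have "(\<Inter>m. ?A m) = {}"
  proof -
    have "x \<notin> (\<Inter>m. ?A m)" for x
    proof -
      obtain m where "\<bar>Z x\<bar> \<le> real m" using real_arch_simple by blast
      then have "x \<notin> ?A m" by simp
      then show ?thesis by blast
    qed
    then show ?thesis by blast
  qed
  ultimately have "(\<lambda>m. measure gauss_borel (?A m)) \<longlonglongrightarrow> 0"
    using gauss.finite_Lim_measure_decseq[of ?A] A by (simp add: image_subset_iff)
  from order_tendstoD(2)[OF this a] obtain m where m: "measure gauss_borel (?A m) < a"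
    by (auto simp: eventually_sequentially)
  have "\<forall>\<^sub>F n in sequentially. real m \<le> e n" using e by (simp add: filterlim_at_top)
  then show "\<forall>\<^sub>F n in sequentially. measure gauss_borel {x. \<bar>Z x\<bar> > e n} < a"
  proof eventually_elim
    case (elim n)
    then have "measure gauss_borel {x. \<bar>Z x\<bar> > e n} \<le> measure gauss_borel (?A m)"
      by (intro gauss.finite_measure_mono[OF _ A]) auto
    with m show ?case by linarith
  qed
qed

text \<open>Three events of probability at most 1/4 cannot cover the space. At a point outside all
  of them, the sum over j + k digits and its two parts are each within t of their centerings, and
  the sums themselves cancel.\<close>

lemma centering_almost_additive:
  fixes F B t
  defines "D \<equiv> \<lambda>j. {x. \<bar>digit_sum F j x - B j\<bar> > t}"
  assumes "measure gauss_borel (D j) \<le> 1 / 4" "measure gauss_borel (D k) \<le> 1 / 4"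
    "measure gauss_borel (D (j + k)) \<le> 1 / 4"
  shows "\<bar>B j + B k - B (j + k)\<bar> \<le> 3 * t"
proof -
  let ?U = "D j \<union> (gauss_map ^^ j) -` D k \<union> D (j + k)"
  have D: "D i \<in> sets borel" for i unfolding D_def by measurable
  have D': "(gauss_map ^^ j) -` D k \<in> sets borel"
    using measurable_sets[OF gauss_map_funpow_measurable D] by simp
  have "measure gauss_borel ?U \<le> measure gauss_borel (D j \<union> (gauss_map ^^ j) -` D k) + measure gauss_borel (D (j + k))"
    using D D' by (intro measure_Un_le) auto
  also have "measure gauss_borel (D j \<union> (gauss_map ^^ j) -` D k)
      \<le> measure gauss_borel (D j) + measure gauss_borel ((gauss_map ^^ j) -` D k)"
    using D D' by (intro measure_Un_le) auto
  also have "measure gauss_borel ((gauss_map ^^ j) -` D k) = measure gauss_borel (D k)"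
    by (rule measure_gauss_map_funpow[OF D])
  finally have "measure gauss_borel ?U \<le> 3 / 4" using assms by simp
  then have "?U \<noteq> UNIV" using gauss.prob_space by auto
  then obtain x where "x \<notin> ?U" by blast
  then have "\<bar>digit_sum F j x - B j\<bar> \<le> t" "\<bar>digit_sum F k ((gauss_map ^^ j) x) - B k\<bar> \<le> t"
    "\<bar>digit_sum F j x + digit_sum F k ((gauss_map ^^ j) x) - B (j + k)\<bar> \<le> t"
    by (auto simp: D_def not_less digit_sum_add)
  then show ?thesis by linarith
qed

text \<open>Split by the first k at which the deviation exceeds 5 t. The remaining sum stays within
  t of its centering with probability at least 3/4, and quasi-independence costs a factor 1/4, so at
  least 3/16 of the event survives; hence 16/3. On the surviving part the deviation at n exceeds 5 t
  - 3 t - t = t, where 3 t is the additivity defect of the centerings.\<close>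

lemma digit_sum_maximal_inequality:
  fixes F B t
  defines "D \<equiv> \<lambda>j. {x. \<bar>digit_sum F j x - B j\<bar> > t}"
  assumes small: "\<And>j. j \<le> n \<Longrightarrow> measure gauss_borel (D j) \<le> 1 / 4"
  shows "measure gauss_borel {x. \<exists>k\<le>n. \<bar>digit_sum F k x - B k\<bar> > 5 * t} \<le> 16 / 3 * measure gauss_borel (D n)"
proof -
  define A where "A = (\<lambda>k. {x. \<bar>digit_sum F k x - B k\<bar> > 5 * t \<and> (\<forall>j<k. \<bar>digit_sum F j x - B j\<bar> \<le> 5 * t)})"
  have D: "D i \<in> sets borel" for i unfolding D_def by measurable
  have A: "A k \<in> sets borel" for k unfolding A_def by measurable
  have G: "(gauss_map ^^ k) -` (- D (n - k)) \<in> sets borel" for k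
    using measurable_sets[OF gauss_map_funpow_measurable, of "- D (n - k)" k] D by simp
  \<comment> \<open>The event of a first exceedance at k reads only k digits, as quasi-independence
    requires of the past.\<close>
  have det: "digits_determine k (A k)" for k
  proof -
    show ?thesis
      using digits_determine_digit_sums[of k "\<lambda>h. \<bar>h k - B k\<bar> > 5 * t \<and> (\<forall>j<k. \<bar>h j - B j\<bar> \<le> 5 * t)" F]
      by (simp add: A_def)
  qed
  have step: "3 / 16 * measure gauss_borel (A k) \<le> measure gauss_borel (A k \<inter> (gauss_map ^^ k) -` (- D (n - k)))"
    if "k \<le> n" for k
  proof -
    have "measure gauss_borel (- D (n - k)) = 1 - measure gauss_borel (D (n - k))"
      using gauss.prob_compl[of "D (n - k)"] D by (simp add: Compl_eq_Diff_UNIV)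
    then have "3 / 4 \<le> measure gauss_borel (- D (n - k))" using small[of "n - k"] by simp
    from mult_left_mono[OF this measure_nonneg[of gauss_borel "A k"]]
    have "3 / 16 * measure gauss_borel (A k) \<le> measure gauss_borel (A k) * measure gauss_borel (- D (n - k)) / 4"
      by simp
    also have "\<dots> \<le> measure gauss_borel (A k \<inter> (gauss_map ^^ k) -` (- D (n - k)))"
      using D A by (intro gauss_quasi_independent det) auto
    finally show ?thesis .
  qed
  have "A j \<inter> A k = {}" if "j < k" for j k
  proof -
    have "x \<notin> A j" if "x \<in> A k" for x
    proof -
      have "\<bar>digit_sum F j x - B j\<bar> \<le> 5 * t" using that \<open>j < k\<close> unfolding A_def by blast
      then show ?thesis by (simp add: A_def)
    qed
    then show ?thesis by blast
  qed
  then have disj: "disjoint_family_on A {..n}"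
    unfolding disjoint_family_on_def by (metis Int_commute linorder_neqE_nat)
  have "{x. \<exists>k\<le>n. \<bar>digit_sum F k x - B k\<bar> > 5 * t} \<subseteq> (\<Union>k\<le>n. A k)"
  proof
    fix x assume "x \<in> {x. \<exists>k\<le>n. \<bar>digit_sum F k x - B k\<bar> > 5 * t}"
    then obtain k where k: "k \<le> n" "\<bar>digit_sum F k x - B k\<bar> > 5 * t" by blast
    define l where "l = (LEAST k. \<bar>digit_sum F k x - B k\<bar> > 5 * t)"
    have "\<bar>digit_sum F l x - B l\<bar> > 5 * t" unfolding l_def by (rule LeastI[of _ k]) (rule k(2))
    moreover have "l \<le> k" unfolding l_def by (rule Least_le) (rule k(2))
    moreover have "\<bar>digit_sum F j x - B j\<bar> \<le> 5 * t" if "j < l" for j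
      using not_less_Least[of j "\<lambda>k. \<bar>digit_sum F k x - B k\<bar> > 5 * t"] that unfolding l_def by linarith
    ultimately show "x \<in> (\<Union>k\<le>n. A k)" using k(1) by (auto simp: A_def)
  qed
  then have "measure gauss_borel {x. \<exists>k\<le>n. \<bar>digit_sum F k x - B k\<bar> > 5 * t} \<le> measure gauss_borel (\<Union>k\<le>n. A k)"
    using A by (intro gauss.finite_measure_mono) auto
  also have "\<dots> = (\<Sum>k\<le>n. measure gauss_borel (A k))"
    using A disj by (intro gauss.finite_measure_finite_Union) auto
  also have "\<dots> \<le> (\<Sum>k\<le>n. 16 / 3 * measure gauss_borel (A k \<inter> (gauss_map ^^ k) -` (- D (n - k))))"
  proof (rule sum_mono)
    fix k assume "k \<in> {..n}"
    then show "measure gauss_borel (A k) \<le> 16 / 3 * measure gauss_borel (A k \<inter> (gauss_map ^^ k) -` (- D (n - k)))"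
      using step[of k] by simp
  qed
  also have "\<dots> = 16 / 3 * (\<Sum>k\<le>n. measure gauss_borel (A k \<inter> (gauss_map ^^ k) -` (- D (n - k))))"
    by (simp only: sum_distrib_left)
  also have "(\<Sum>k\<le>n. measure gauss_borel (A k \<inter> (gauss_map ^^ k) -` (- D (n - k))))
      = measure gauss_borel (\<Union>k\<le>n. A k \<inter> (gauss_map ^^ k) -` (- D (n - k)))"
  proof (rule gauss.finite_measure_finite_Union[symmetric])
    show "disjoint_family_on (\<lambda>k. A k \<inter> (gauss_map ^^ k) -` (- D (n - k))) {..n}"
      using disj unfolding disjoint_family_on_def by blast
    show "(\<lambda>k. A k \<inter> (gauss_map ^^ k) -` (- D (n - k))) ` {..n} \<subseteq> sets gauss_borel"
      unfolding sets_gauss_borel using A G by blast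
  qed simp
  also have "\<dots> \<le> measure gauss_borel (D n)"
  proof (rule gauss.finite_measure_mono)
    show "(\<Union>k\<le>n. A k \<inter> (gauss_map ^^ k) -` (- D (n - k))) \<subseteq> D n"
    proof
      fix x assume "x \<in> (\<Union>k\<le>n. A k \<inter> (gauss_map ^^ k) -` (- D (n - k)))"
      then obtain k where k: "k \<le> n" "x \<in> A k" "(gauss_map ^^ k) x \<notin> D (n - k)" by auto
      have "\<bar>B k + B (n - k) - B (k + (n - k))\<bar> \<le> 3 * t"
        using small k(1) unfolding D_def by (intro centering_almost_additive[where F = F]) auto
      moreover have "digit_sum F (k + (n - k)) x = digit_sum F k x + digit_sum F (n - k) ((gauss_map ^^ k) x)"
        by (rule digit_sum_add)
      moreover have "k + (n - k) = n" using k(1) by simp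
      moreover have "5 * t < \<bar>digit_sum F k x - B k\<bar>" using k(2) by (simp add: A_def)
      moreover have "\<bar>digit_sum F (n - k) ((gauss_map ^^ k) x) - B (n - k)\<bar> \<le> t" using k(3) by (simp add: D_def)
      ultimately have "t < \<bar>digit_sum F n x - B n\<bar>" by (simp add: abs_if split: if_splits)
      then show "x \<in> D n" by (simp add: D_def)
    qed
  qed (use D in auto)
  finally show ?thesis by simp
qed

text \<open>Given that R has been avoided so far, the next digit satisfies R with at least a quarter
  of its unconditional probability p, so each step keeps at most the fraction 1 - p / 4.\<close>

lemma measure_digits_avoid_le:
  "measure gauss_borel {x. \<forall>k<n. \<not> R (digit k x)} \<le> (1 - measure gauss_borel {x. R (digit 0 x)} / 4) ^ n"
proof (induction n)
  case 0
  show ?case using gauss.prob_space by simp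
next
  case (Suc n)
  let ?p = "measure gauss_borel {x. R (digit 0 x)}"
  let ?Q = "\<lambda>n. {x. \<forall>k<n. \<not> R (digit k x)}" and ?E = "{x. R (digit 0 x)}"
  have Q: "?Q n \<in> sets borel" for n by measurable
  have E: "?E \<in> sets borel" by measurable
  have E': "(gauss_map ^^ n) -` ?E \<in> sets borel"
    using measurable_sets[OF gauss_map_funpow_measurable E] by simp
  have "?Q (Suc n) = ?Q n - (?Q n \<inter> (gauss_map ^^ n) -` ?E)"
    by (auto simp: less_Suc_eq digit_funpow)
  then have "measure gauss_borel (?Q (Suc n)) = measure gauss_borel (?Q n) - measure gauss_borel (?Q n \<inter> (gauss_map ^^ n) -` ?E)"
    using Q E' by (simp only:) (intro gauss.finite_measure_Diff, auto)
  also have "\<dots> \<le> measure gauss_borel (?Q n) - measure gauss_borel (?Q n) * ?p / 4"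
  proof -
    have "digits_determine n (?Q n)" by (auto simp: digits_determine_def)
    from gauss_quasi_independent[OF this Q E] show ?thesis by simp
  qed
  also have "\<dots> = measure gauss_borel (?Q n) * (1 - ?p / 4)" by (simp add: algebra_simps)
  also have "\<dots> \<le> (1 - ?p / 4) ^ n * (1 - ?p / 4)"
  proof (rule mult_right_mono[OF Suc.IH])
    show "0 \<le> 1 - ?p / 4" using gauss.prob_le_1[of ?E] by linarith
  qed
  finally show ?case by (simp add: mult.commute)
qed

text \<open>If q is the probability that none of the n digits satisfies \<open>R n\<close>, then q
  <= (1 - p / 4)^n <= exp (- n p / 4), so n p <= -4 ln q, which tends to 0 since q tends to
  1.\<close>

lemma scaled_tail_tendsto_0:
  assumes "(\<lambda>n. measure gauss_borel {x. \<exists>k<n. R n (digit k x)}) \<longlonglongrightarrow> 0"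
  shows "(\<lambda>n. real n * measure gauss_borel {x. R n (digit 0 x)}) \<longlonglongrightarrow> 0"
proof -
  let ?p = "\<lambda>n. measure gauss_borel {x. R n (digit 0 x)}"
  let ?q = "\<lambda>n. 1 - measure gauss_borel {x. \<exists>k<n. R n (digit k x)}"
  have q: "?q \<longlonglongrightarrow> 1" using tendsto_diff[OF tendsto_const assms, of 1] by simp
  have "(\<lambda>n. - 4 * ln (?q n)) \<longlonglongrightarrow> - 4 * ln 1"
    by (intro tendsto_mult tendsto_const tendsto_ln q) simp
  then have lim: "(\<lambda>n. - 4 * ln (?q n)) \<longlonglongrightarrow> 0" by simp
  have "\<forall>\<^sub>F n in sequentially. norm (real n * ?p n) \<le> - 4 * ln (?q n)"
    using order_tendstoD(1)[OF q zero_less_one]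
  proof eventually_elim
    case (elim n)
    have M: "{x. \<exists>k<n. R n (digit k x)} \<in> sets gauss_borel"
      unfolding sets_gauss_borel by measurable
    have "?q n = measure gauss_borel (UNIV - {x. \<exists>k<n. R n (digit k x)})"
      using gauss.prob_compl[OF M] by simp
    also have "UNIV - {x. \<exists>k<n. R n (digit k x)} = {x. \<forall>k<n. \<not> R n (digit k x)}" by auto
    also have "measure gauss_borel \<dots> \<le> (1 - ?p n / 4) ^ n" by (rule measure_digits_avoid_le)
    also have "\<dots> \<le> exp (- ?p n / 4) ^ n"
    proof (rule power_mono)
      show "1 - ?p n / 4 \<le> exp (- ?p n / 4)" using exp_ge_add_one_self[of "- ?p n / 4"] by simp
      show "0 \<le> 1 - ?p n / 4" using gauss.prob_le_1[of "{x. R n (digit 0 x)}"] by linarith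
    qed
    also have "\<dots> = exp (- (real n * ?p n / 4))" by (simp add: exp_of_nat_mult[symmetric])
    finally have le: "?q n \<le> exp (- (real n * ?p n / 4))" .
    have "ln (?q n) \<le> ln (exp (- (real n * ?p n / 4)))"
      by (subst ln_le_cancel_iff) (rule elim, rule exp_gt_zero, rule le)
    then show ?case by simp
  qed
  then show ?thesis by (rule Lim_null_comparison[OF _ lim])
qed

text \<open>The maximal inequality at level \<open>c n\<close> needs all partial sums up to n,
  whereas the weak law controls the j-th sum only at its own level \<open>c j\<close>. Bridging this
  gap is the purpose of the monotonicity and divergence of c.\<close>

lemma weak_law_necessity:
  fixes c :: "nat \<Rightarrow> real" and F :: "nat \<Rightarrow> real"
  assumes N: "\<And>m n. N \<le> m \<Longrightarrow> m \<le> n \<Longrightarrow> c m \<le> c n"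
    and top: "filterlim c at_top sequentially"
    and conv: "\<And>\<epsilon>. 0 < \<epsilon> \<Longrightarrow>
      (\<lambda>n. measure gauss_borel {x. \<bar>digit_sum F n x - B n\<bar> > \<epsilon> * c n}) \<longlonglongrightarrow> 0"
  shows "(\<lambda>n. real n * measure gauss_borel {x. \<bar>F (digit 0 x)\<bar> > c n}) \<longlonglongrightarrow> 0"
proof (rule scaled_tail_tendsto_0)
  \<comment> \<open>A single summand is \<open>c n\<close> times at most \<open>(5 + 5 + 3 + 1) \<epsilon>\<close>.\<close>
  define \<epsilon> :: real where "\<epsilon> = 1 / 15"
  have \<epsilon>: "0 < \<epsilon>" by (simp add: \<epsilon>_def)
  define D where "D = (\<lambda>n j. {x. \<bar>digit_sum F j x - B j\<bar> > \<epsilon> * c n})"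
  have M: "D n j \<in> sets gauss_borel" for n j
    unfolding D_def sets_gauss_borel by measurable
  \<comment> \<open>For large j, monotonicity passes from level \<open>c j\<close> to
    \<open>c n\<close>. The finitely many short sums are fixed random variables, which a level
    tending to infinity eventually dominates.\<close>
  have small: "\<forall>\<^sub>F n in sequentially. \<forall>j\<le>n. measure gauss_borel (D n j) \<le> 1 / 4"
  proof -
    have "\<forall>\<^sub>F n in sequentially. measure gauss_borel (D n n) < 1 / 4"
      using order_tendstoD(2)[OF conv[OF \<epsilon>], of "1 / 4"] by (simp add: D_def)
    then obtain J0 where J0: "\<And>n. J0 \<le> n \<Longrightarrow> measure gauss_borel (D n n) < 1 / 4"
      by (auto simp: eventually_sequentially)
    define J where "J = max N J0"
    have "\<forall>\<^sub>F n in sequentially. measure gauss_borel (D n j) < 1 / 4" for j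
    proof -
      have "filterlim (\<lambda>n. \<epsilon> * c n) at_top sequentially"
        by (rule filterlim_tendsto_pos_mult_at_top[OF tendsto_const \<epsilon> top])
      from gauss_tail_tendsto_0[OF _ this, of "\<lambda>x. digit_sum F j x - B j"]
      have "(\<lambda>n. measure gauss_borel (D n j)) \<longlonglongrightarrow> 0" by (simp add: D_def)
      then show ?thesis by (rule order_tendstoD(2)) simp
    qed
    then have "\<forall>\<^sub>F n in sequentially. \<forall>j\<in>{..<J}. measure gauss_borel (D n j) < 1 / 4"
      by (intro eventually_ball_finite) auto
    then show ?thesis
    proof eventually_elim
      case (elim n)
      show ?case
      proof (intro allI impI)
        fix j assume "j \<le> n"
        show "measure gauss_borel (D n j) \<le> 1 / 4"
        proof (cases "j < J")
          case True
          then show ?thesis using elim less_imp_le by blast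
        next
          case False
          then have "\<epsilon> * c j \<le> \<epsilon> * c n"
            using N[of j n] \<open>j \<le> n\<close> \<epsilon> by (intro mult_left_mono) (auto simp: J_def)
          then have "measure gauss_borel (D n j) \<le> measure gauss_borel (D j j)"
            by (intro gauss.finite_measure_mono[OF _ M]) (auto simp: D_def)
          moreover have "J0 \<le> j" using False by (simp add: J_def)
          ultimately show ?thesis using J0[of j] by linarith
        qed
      qed
    qed
  qed
  have B1: "\<forall>\<^sub>F n in sequentially. \<bar>B 1\<bar> / \<epsilon> \<le> c n" using top by (simp add: filterlim_at_top)
  have "\<forall>\<^sub>F n in sequentially. norm (measure gauss_borel {x. \<exists>k<n. c n < \<bar>F (digit k x)\<bar>})
      \<le> 16 / 3 * measure gauss_borel (D n n)"
    using small B1 eventually_gt_at_top[of 0] filterlim_at_top_dense[THEN iffD1, OF top, rule_format, of 0]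
  proof eventually_elim
    case (elim n)
    let ?E = "{x. \<exists>k\<le>n. \<bar>digit_sum F k x - B k\<bar> > 5 * (\<epsilon> * c n)}"
    have "{x. \<exists>k<n. c n < \<bar>F (digit k x)\<bar>} \<subseteq> ?E"
    proof (rule subsetI, rule ccontr)
      fix x assume "x \<in> {x. \<exists>k<n. c n < \<bar>F (digit k x)\<bar>}" "x \<notin> ?E"
      then obtain k where k: "k < n" "c n < \<bar>F (digit k x)\<bar>"
        and E: "\<And>k. k \<le> n \<Longrightarrow> \<bar>digit_sum F k x - B k\<bar> \<le> 5 * (\<epsilon> * c n)"
        by (auto simp: not_less)
      \<comment> \<open>A summand is the difference of two consecutive partial sums. Their
        centerings differ by \<open>B 1\<close> up to the additivity defect, and \<open>B 1\<close>
        is fixed while \<open>c n\<close> grows.\<close>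
      have "\<bar>B k + B 1 - B (k + 1)\<bar> \<le> 3 * (\<epsilon> * c n)"
        using elim(1,3) k(1) unfolding D_def by (intro centering_almost_additive[where F = F]) auto
      moreover have "\<bar>B 1\<bar> \<le> \<epsilon> * c n" using elim(2) \<epsilon> by (simp add: field_simps)
      moreover have "\<bar>digit_sum F k x - B k\<bar> \<le> 5 * (\<epsilon> * c n)" "\<bar>digit_sum F (k + 1) x - B (k + 1)\<bar> \<le> 5 * (\<epsilon> * c n)"
        using E[of k] E[of "k + 1"] k(1) by auto
      moreover have "digit_sum F (k + 1) x = digit_sum F k x + F (digit k x)" by (simp add: digit_sum_def)
      ultimately have "\<bar>F (digit k x)\<bar> \<le> 14 * (\<epsilon> * c n)" by (simp add: abs_if split: if_splits)
      also have "\<dots> \<le> c n" using elim(4) by (simp add: \<epsilon>_def)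
      finally show False using k(2) by simp
    qed
    moreover have "?E \<in> sets gauss_borel" unfolding sets_gauss_borel by measurable
    ultimately have "measure gauss_borel {x. \<exists>k<n. c n < \<bar>F (digit k x)\<bar>} \<le> measure gauss_borel ?E"
      by (rule gauss.finite_measure_mono)
    also have "\<dots> \<le> 16 / 3 * measure gauss_borel (D n n)"
      unfolding D_def using elim(1) unfolding D_def by (intro digit_sum_maximal_inequality) auto
    finally show ?case by simp
  qed
  moreover have "(\<lambda>n. 16 / 3 * measure gauss_borel (D n n)) \<longlonglongrightarrow> 0"
    using tendsto_mult_right_zero[OF conv[OF \<epsilon>], of "16 / 3"] by (simp add: D_def)
  ultimately show "(\<lambda>n. measure gauss_borel {x. \<exists>k<n. c n < \<bar>F (digit k x)\<bar>}) \<longlonglongrightarrow> 0"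
    by (rule Lim_null_comparison)
qed

section \<open>The weak law\<close>

lemma normalizing_sequence_at_top:
  fixes c :: "nat \<Rightarrow> real"
  assumes c: "\<And>n. n \<ge> 1 \<Longrightarrow> c n > 0"
    and lim: "liminf (\<lambda>n. ereal (real n / (c n)\<^sup>2 * ((c (Suc n))\<^sup>2 - (c n)\<^sup>2))) > 1"
  shows "(\<exists>N. \<forall>m n. N \<le> m \<longrightarrow> m \<le> n \<longrightarrow> c m \<le> c n) \<and> filterlim c at_top sequentially"
proof (rule normalizing_sequence_growth[OF c lim])
  fix C N
  assume mono: "\<And>m n. N \<le> m \<Longrightarrow> m \<le> n \<Longrightarrow> c m \<le> c n"
    and top: "filterlim (\<lambda>n. (c n)\<^sup>2 / real n) at_top sequentially"
  have "filterlim c at_top sequentially"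
    unfolding filterlim_at_top
  proof
    fix Z :: real
    have "\<forall>\<^sub>F n in sequentially. Z\<^sup>2 \<le> (c n)\<^sup>2 / real n" using top by (simp add: filterlim_at_top)
    then show "\<forall>\<^sub>F n in sequentially. Z \<le> c n"
      using eventually_ge_at_top[of 1]
    proof eventually_elim
      case (elim n)
      have "(c n)\<^sup>2 / real n \<le> (c n)\<^sup>2 / 1" using elim(2) by (intro divide_left_mono) auto
      then have "Z\<^sup>2 \<le> (c n)\<^sup>2" using elim(1) by simp
      then have "\<bar>Z\<bar> \<le> \<bar>c n\<bar>" by (simp only: abs_le_square_iff)
      then show ?case using c[OF elim(2)] by linarith
    qed
  qed
  with mono show ?thesis by blast
qed

section \<open>Transfer to \<open>gauss_measure\<close> and \<open>cf_digit\<close>\<close>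

lemma AE_gauss_measure_irr_unit: "AE x in gauss_measure. x \<in> irr_unit"
  using AE_irr_unit unfolding gauss_borel_def
  by (subst (asm) AE_distr_iff[OF measurable_ident_gauss_measure]) auto

lemma cf_digit_eq_digit: "x \<in> irr_unit \<Longrightarrow> cf_digit (Suc k) x = digit k x"
  by (simp add: irr_unit_def cf_digit_eq digit_def)

text \<open>On the rationals \<open>cf_digit\<close> is an unspecified constant, but
  \<open>cf_digit (Suc k)\<close> can differ from \<open>digit k\<close> only on a countable set,
  and singletons are measurable.\<close>

lemma cf_digit_measurable [measurable]:
  "cf_digit (Suc k) \<in> gauss_measure \<rightarrow>\<^sub>M count_space UNIV"
proof (rule measurable_discrete_difference)
  show "digit k \<in> gauss_measure \<rightarrow>\<^sub>M count_space UNIV"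
    using measurable_compose[OF measurable_ident_gauss_measure digit_measurable] by simp
  show "countable ({0<..1} - irr_unit)"
    by (rule countable_subset[of _ "insert 1 \<rat>"]) (auto simp: irr_unit_def countable_rat)
  fix x :: real
  assume "x \<in> {0<..1} - irr_unit"
  then show "{x} \<in> sets gauss_measure"
    by (auto simp: sets_gauss_measure sets_restrict_space intro!: image_eqI[of _ _ "{x}"])
next
  fix x assume "x \<in> space gauss_measure" "x \<notin> {0<..1} - irr_unit"
  then show "digit k x = cf_digit (Suc k) x" by (simp add: cf_digit_eq_digit)
qed simp_all

lemma measure_gauss_measure_eq:
  assumes "{x \<in> space gauss_measure. P x} \<in> sets gauss_measure" "{x. Q x} \<in> sets borel"
    and PQ: "\<And>x. x \<in> irr_unit \<Longrightarrow> P x \<longleftrightarrow> Q x"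
  shows "measure gauss_measure {x \<in> space gauss_measure. P x} = measure gauss_borel {x. Q x}"
proof -
  have Q: "{x \<in> space gauss_measure. Q x} \<in> sets gauss_measure"
    using measurable_sets[OF measurable_ident_gauss_measure assms(2)] by (simp add: vimage_def Int_def conj_commute)
  have "measure gauss_borel {x. Q x} = measure gauss_measure {x \<in> space gauss_measure. Q x}"
    unfolding gauss_borel_def using measure_distr[OF measurable_ident_gauss_measure assms(2)]
    by (simp add: vimage_def Int_def conj_commute)
  moreover have "measure gauss_measure {x \<in> space gauss_measure. P x} = measure gauss_measure {x \<in> space gauss_measure. Q x}"
    by (rule measure_eq_AE[OF _ assms(1) Q], rule eventually_mono[OF AE_gauss_measure_irr_unit]) (use PQ in auto)
  ultimately show ?thesis by simp
qed

text \<open>By stationarity the value does not depend on k, so all summands of the theorem share one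
  centering constant.\<close>

lemma integral_cf_digit:
  fixes g :: "nat \<Rightarrow> real"
  shows "(\<integral>x. g (cf_digit (Suc k) x) \<partial>gauss_measure) = (\<integral>x. g (digit 0 x) \<partial>gauss_borel)"
proof -
  have m: "(\<lambda>x. g (digit k x)) \<in> borel_measurable gauss_measure"
    using measurable_compose[OF measurable_ident_gauss_measure digit_fun_measurable] by simp
  have "(\<integral>x. g (cf_digit (Suc k) x) \<partial>gauss_measure) = (\<integral>x. g (digit k x) \<partial>gauss_measure)"
    by (rule integral_cong_AE[OF _ m], measurable, rule eventually_mono[OF AE_gauss_measure_irr_unit])
      (simp add: cf_digit_eq_digit)
  also have "\<dots> = (\<integral>x. g (digit k x) \<partial>gauss_borel)"
    unfolding gauss_borel_def by (rule integral_distr[symmetric, OF measurable_ident_gauss_measure digit_fun_measurable])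
  also have "\<dots> = (\<integral>x. g (digit 0 x) \<partial>gauss_borel)" by (rule integral_digit)
  finally show ?thesis .
qed

theorem theorem2:
  fixes c :: "nat \<Rightarrow> real" and f :: "real \<Rightarrow> real"
  assumes "\<And>n. n \<ge> 1 \<Longrightarrow> c n > 0"
    and "liminf (\<lambda>n. ereal (real n / (c n)\<^sup>2 * ((c (Suc n))\<^sup>2 - (c n)\<^sup>2))) > 1"
    and "f \<in> borel_measurable borel"
  shows "tendsto_in_prob gauss_measure
      (\<lambda>n x. inverse (c n) *
        (\<Sum>k=1..n. f (real (cf_digit k x)) -
          (\<integral>y. f (real (cf_digit k y)) *
             indicator {y. \<bar>f (real (cf_digit k y))\<bar> \<le> c n} y \<partial>gauss_measure)))
      (\<lambda>x. 0)
    \<longleftrightarrow>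
    (\<lambda>n. real n * measure gauss_measure
        {x \<in> space gauss_measure. \<bar>f (real (cf_digit 1 x))\<bar> > c n}) \<longlonglongrightarrow> 0"
proof -
  define F where "F = (\<lambda>m::nat. f (real m))"
  define g where "g = (\<lambda>n m. F m * indicator {m. \<bar>F m\<bar> \<le> c n} m)"
  define v where "v = (\<lambda>n. \<integral>x. g n (digit 0 x) \<partial>gauss_borel)"
  define T where "T = (\<lambda>n. measure gauss_borel {x. \<bar>F (digit 0 x)\<bar> > c n})"
  define V where "V = (\<lambda>n. \<integral>x. (g n (digit 0 x))\<^sup>2 \<partial>gauss_borel)"
  have tail: "measure gauss_measure {x \<in> space gauss_measure. \<bar>f (real (cf_digit 1 x))\<bar> > c n} = T n" for n
    unfolding T_def F_def One_nat_def
    by (rule measure_gauss_measure_eq) (measurable, simp add: cf_digit_eq_digit)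
  have centre: "(\<integral>y. f (real (cf_digit (Suc k) y)) * indicator {y. \<bar>f (real (cf_digit (Suc k) y))\<bar> \<le> c n} y \<partial>gauss_measure) = v n" for k n
    using integral_cf_digit[of "g n" k] by (simp add: v_def g_def F_def indicator_def)
  have sum: "(\<Sum>k=1..n. f (real (cf_digit k x)) -
      (\<integral>y. f (real (cf_digit k y)) * indicator {y. \<bar>f (real (cf_digit k y))\<bar> \<le> c n} y \<partial>gauss_measure))
    = (\<Sum>k<n. F (cf_digit (Suc k) x) - v n)" for n x
    by (simp only: One_nat_def sum.atLeast1_atMost_eq centre F_def)
  \<comment> \<open>Multiplying by \<open>c n\<close> requires its positivity, which is given from n
    = 1 on; the limits ignore n = 0.\<close>
  have dev: "measure gauss_measure {x \<in> space gauss_measure. \<bar>inverse (c n) * (\<Sum>k<n. F (cf_digit (Suc k) x) - v n) - 0\<bar> > \<epsilon>}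
      = measure gauss_borel {x. \<bar>\<Sum>k<n. F (digit k x) - v n\<bar> > \<epsilon> * c n}" if "1 \<le> n" for n \<epsilon>
  proof (rule measure_gauss_measure_eq)
    show "{x. \<bar>\<Sum>k<n. F (digit k x) - v n\<bar> > \<epsilon> * c n} \<in> sets borel" by measurable
    fix x assume "x \<in> irr_unit"
    then show "\<bar>inverse (c n) * (\<Sum>k<n. F (cf_digit (Suc k) x) - v n) - 0\<bar> > \<epsilon> \<longleftrightarrow> \<bar>\<Sum>k<n. F (digit k x) - v n\<bar> > \<epsilon> * c n"
      using assms(1)[OF that] by (simp only: cf_digit_eq_digit) (simp add: abs_mult field_simps)
  qed measurable
  have in_prob: "tendsto_in_prob gauss_measure (\<lambda>n x. inverse (c n) * (\<Sum>k<n. F (cf_digit (Suc k) x) - v n)) (\<lambda>x. 0)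
    \<longleftrightarrow> (\<forall>\<epsilon>>0. (\<lambda>n. measure gauss_borel {x. \<bar>\<Sum>k<n. F (digit k x) - v n\<bar> > \<epsilon> * c n}) \<longlonglongrightarrow> 0)"
  proof -
    have "((\<lambda>n. measure gauss_measure {x \<in> space gauss_measure.
          \<bar>inverse (c n) * (\<Sum>k<n. F (cf_digit (Suc k) x) - v n) - 0\<bar> > \<epsilon>}) \<longlonglongrightarrow> 0)
      \<longleftrightarrow> ((\<lambda>n. measure gauss_borel {x. \<bar>\<Sum>k<n. F (digit k x) - v n\<bar> > \<epsilon> * c n}) \<longlonglongrightarrow> 0)" for \<epsilon>
      by (rule filterlim_cong[OF refl refl], rule eventually_mono[OF eventually_ge_at_top[of 1]], rule dev)
    then show ?thesis unfolding tendsto_in_prob_def by (simp only:)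
  qed
  obtain N where N: "\<And>m n. N \<le> m \<Longrightarrow> m \<le> n \<Longrightarrow> c m \<le> c n"
    and ctop: "filterlim c at_top sequentially"
    using normalizing_sequence_at_top[OF assms(1,2)] by auto
  have "(\<forall>\<epsilon>>0. (\<lambda>n. measure gauss_borel {x. \<bar>\<Sum>k<n. F (digit k x) - v n\<bar> > \<epsilon> * c n}) \<longlonglongrightarrow> 0)
    \<longleftrightarrow> (\<lambda>n. real n * T n) \<longlonglongrightarrow> 0"
  proof
    assume "\<forall>\<epsilon>>0. (\<lambda>n. measure gauss_borel {x. \<bar>\<Sum>k<n. F (digit k x) - v n\<bar> > \<epsilon> * c n}) \<longlonglongrightarrow> 0"
    \<comment> \<open>The total centering n v n is not additive in n, since the truncation level in
      v moves with n. This is why necessity is proved for a general centering B.\<close>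
    moreover have "(\<Sum>k<n. F (digit k x) - v n) = digit_sum F n x - real n * v n" for n x
      by (simp add: digit_sum_def sum_subtractf)
    ultimately show "(\<lambda>n. real n * T n) \<longlonglongrightarrow> 0"
      unfolding T_def by (intro weak_law_necessity[OF N ctop, where B = "\<lambda>n. real n * v n"]) simp_all
  next
    assume nT: "(\<lambda>n. real n * T n) \<longlonglongrightarrow> 0"
    have "(\<lambda>x. F (digit 0 x)) \<in> borel_measurable gauss_borel" by measurable
    from truncated_second_moment_tendsto[OF gauss.prob_space_axioms this assms(1,2)]
    have nV: "(\<lambda>n. real n / (c n)\<^sup>2 * V n) \<longlonglongrightarrow> 0"
      using nT by (simp add: T_def V_def g_def indicator_def)
    show "\<forall>\<epsilon>>0. (\<lambda>n. measure gauss_borel {x. \<bar>\<Sum>k<n. F (digit k x) - v n\<bar> > \<epsilon> * c n}) \<longlonglongrightarrow> 0"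
    proof (intro allI impI)
      fix \<epsilon> :: real assume \<epsilon>: "0 < \<epsilon>"
      have "(\<lambda>n. real n * T n + 130 / \<epsilon>\<^sup>2 * (real n / (c n)\<^sup>2 * V n)) \<longlonglongrightarrow> 0 + 130 / \<epsilon>\<^sup>2 * 0"
        by (intro tendsto_add tendsto_mult tendsto_const nT nV)
      then have lim: "(\<lambda>n. real n * T n + 130 / \<epsilon>\<^sup>2 * (real n / (c n)\<^sup>2 * V n)) \<longlonglongrightarrow> 0" by simp
      show "(\<lambda>n. measure gauss_borel {x. \<bar>\<Sum>k<n. F (digit k x) - v n\<bar> > \<epsilon> * c n}) \<longlonglongrightarrow> 0"
      proof (rule Lim_null_comparison[OF eventually_mono[OF eventually_ge_at_top[of 1]] lim])
        fix n :: nat assume n: "1 \<le> n"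
        have "0 < \<epsilon> * c n" using \<epsilon> assms(1)[OF n] by simp
        from truncated_sum_deviation[OF this, where F = F and c = "c n" and n = n]
        show "norm (measure gauss_borel {x. \<bar>\<Sum>k<n. F (digit k x) - v n\<bar> > \<epsilon> * c n})
            \<le> real n * T n + 130 / \<epsilon>\<^sup>2 * (real n / (c n)\<^sup>2 * V n)"
          by (simp add: T_def V_def v_def g_def power_mult_distrib)
      qed
    qed
  qed
  then show ?thesis unfolding sum in_prob tail .
qed

end
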